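(* Let $\Sigma$ be an intrinsic rotational surface of $\mathbf{E}_1^3$ with zero mean curvature and constant twist $\alpha(v)=c$, $c\in\mathbb{R}$. Then $\Sigma$ is an associate surface of a surface of revolution with zero mean curvature.
   Context: $\mathbf{E}_1^3$ is $\mathbb{R}^3$ with the Lorentzian metric $\langle,\rangle=dx_1^2+dx_2^2-dx_3^2$. A non-degenerate surface is spacelike if its induced metric is Riemannian and timelike if it is Lorentzian. A non-degenerate surface $\Sigma$ is an intrinsic rotational surface if it has local coordinates $(u,v)$, ranging over a product of open intervals, in which the first fundamental form is $\mathrm{I}=\rho(u)^2(\delta\,du^2+\epsilon\,dv^2)$ with $\delta,\epsilon\in\{-1,1\}$ (not both $-1$) and $\rho>0$ a smooth function of $u$ only. Let $N$ be a unit normal field, $\langle N,N\rangle=-\sigma$, with $\sigma=1$ if $\Sigma$ is spacelike and $\sigma=-1$ if it is timelike. The Weingarten endomorphism is $AX=-(\nabla^0_XN)^\top$, with $\nabla^0$ the Levi-Civita connection of $\mathbf{E}_1^3$; when $A$ is (real) diagonalizable its eigenvalues $\lambda_1,\lambda_2$ are the principal curvatures, and the mean curvature is $H=-\sigma\frac{\lambda_1+\lambda_2}{2}$. Put $R_\theta=\begin{pmatrix}\cos\theta&-\sin\theta\\ \sin\theta&\cos\theta\end{pmatrix}$ and $G_\theta=\begin{pmatrix}\cosh\theta&\sinh\theta\\ \sinh\theta&\cosh\theta\end{pmatrix}$. $\Sigma$ has twist $\alpha$ if $A$ is diagonalizable and its matrix with respect to $\{\partial_u,\partial_v\}$ is $R_{-\alpha(v)}\,\mathrm{diag}(\lambda_1(u),\lambda_2(u))\,R_{\alpha(v)}$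 when $\Sigma$ is spacelike, respectively $G_{-\alpha(v)}\,\mathrm{diag}(\lambda_1(u),\lambda_2(u))\,G_{\alpha(v)}$ when $\Sigma$ is timelike, with $\lambda_1,\lambda_2$ depending only on $u$. Associate surfaces. If $X=X(u,v)$ is a conformal spacelike immersion with zero mean curvature (on a simply connected domain), its conjugate $X^*$ is the map (unique up to translation) such that $X+iX^*$ is holomorphic in $u+iv$, and the associate surfaces of $X$ are $X^\theta=\cos\theta\,X+\sin\theta\,X^*$, $\theta\in\mathbb{R}$. If $X=X(u,v)$ is a timelike immersion with zero mean curvature and metric a multiple of $du^2-dv^2$, its paraconjugate $X^*$ is the map (unique up to translation) with $X_u=X^*_v$, $X_v=X^*_u$, and the associate surfaces of $X$ are $X^\theta=\cosh\theta\,X+\sinh\theta\,X^*$, $\theta\in\mathbb{R}$. A surface of revolution in $\mathbf{E}_1^3$ is a surface invariant under (i.e. obtained by moving a curve by) a one-parameter group of rotations of $\mathbf{E}_1^3$, that is, of isometries of $\mathbf{E}_1^3$ fixing pointwise a line (the rotation axis, which may be spacelike, timelike or lightlike); the statement is local, so open pieces of such surfaces are allowed. *)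

theory Defs
  imports "HOL-Analysis.Analysis"
begin

(* A surface in E_1^3 is given by a parametrization X on an open set U of the (u,v)-plane.
   U is always open, so derivatives at points of U only depend on the values of X on U. *)

section \<open>Smooth maps\<close>

primrec Ck_on :: "nat \<Rightarrow> 'a::euclidean_space set \<Rightarrow> ('a \<Rightarrow> 'b::euclidean_space) \<Rightarrow> bool" where
  "Ck_on 0 S f \<longleftrightarrow> continuous_on S f"
| "Ck_on (Suc n) S f \<longleftrightarrow> (\<forall>x\<in>S. f differentiable (at x)) \<and>
     (\<forall>w. Ck_on n S (\<lambda>x. frechet_derivative f (at x) w))"

definition smooth_on :: "'a::euclidean_space set \<Rightarrow> ('a \<Rightarrow> 'b::euclidean_space) \<Rightarrow> bool" where
  "smooth_on S f \<longleftrightarrow> (\<forall>n. Ck_on n S f)"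

definition open_interval :: "real set \<Rightarrow> bool" where
  "open_interval I \<longleftrightarrow> open I \<and> is_interval I \<and> I \<noteq> {}"

abbreviation partial_u :: "(real \<times> real \<Rightarrow> 'b::real_normed_vector) \<Rightarrow> real \<times> real \<Rightarrow> 'b" where
  "partial_u f p \<equiv> frechet_derivative f (at p) (1, 0)"

abbreviation partial_v :: "(real \<times> real \<Rightarrow> 'b::real_normed_vector) \<Rightarrow> real \<times> real \<Rightarrow> 'b" where
  "partial_v f p \<equiv> frechet_derivative f (at p) (0, 1)"

section \<open>Surfaces in Minkowski space\<close>

definition lorentz :: "real ^ 3 \<Rightarrow> real ^ 3 \<Rightarrow> real" where
  "lorentz x y = x $ 1 * y $ 1 + x $ 2 * y $ 2 - x $ 3 * y $ 3"

definition fundform1 ::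
  "(real \<times> real \<Rightarrow> real ^ 3) \<Rightarrow> real \<times> real \<Rightarrow> real \<times> real \<Rightarrow> real \<times> real \<Rightarrow> real" where
  "fundform1 X p w z = lorentz (frechet_derivative X (at p) w) (frechet_derivative X (at p) z)"

definition spacelike_at :: "(real \<times> real \<Rightarrow> real ^ 3) \<Rightarrow> real \<times> real \<Rightarrow> bool" where
  "spacelike_at X p \<longleftrightarrow> (\<forall>w. w \<noteq> 0 \<longrightarrow> fundform1 X p w w > 0)"

(* In dimension two, a symmetric bilinear form taking both signs is automatically
   non-degenerate of signature (1,1), i.e. Lorentzian. *)
definition timelike_at :: "(real \<times> real \<Rightarrow> real ^ 3) \<Rightarrow> real \<times> real \<Rightarrow> bool" where
  "timelike_at X p \<longleftrightarrow> (\<exists>w. fundform1 X p w w > 0) \<and> (\<exists>w. fundform1 X p w w < 0)"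

definition spacelike_surface :: "(real \<times> real) set \<Rightarrow> (real \<times> real \<Rightarrow> real ^ 3) \<Rightarrow> bool" where
  "spacelike_surface U X \<longleftrightarrow> open U \<and> smooth_on U X \<and> (\<forall>p\<in>U. spacelike_at X p)"

definition timelike_surface :: "(real \<times> real) set \<Rightarrow> (real \<times> real \<Rightarrow> real ^ 3) \<Rightarrow> bool" where
  "timelike_surface U X \<longleftrightarrow> open U \<and> smooth_on U X \<and> (\<forall>p\<in>U. timelike_at X p)"

(* Both alternatives force X to be an immersion. *)
definition nondegenerate_surface :: "(real \<times> real) set \<Rightarrow> (real \<times> real \<Rightarrow> real ^ 3) \<Rightarrow> bool" where
  "nondegenerate_surface U X \<longleftrightarrow> spacelike_surface U X \<or> timelike_surface U X"

definition intrinsic_rotational_surface ::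
  "real set \<Rightarrow> real set \<Rightarrow> (real \<times> real \<Rightarrow> real ^ 3) \<Rightarrow> bool" where
  "intrinsic_rotational_surface I J X \<longleftrightarrow>
     open_interval I \<and> open_interval J \<and> nondegenerate_surface (I \<times> J) X \<and>
     (\<exists>\<delta> \<epsilon> :: real. \<exists>\<rho> :: real \<Rightarrow> real.
        \<delta> \<in> {-1, 1} \<and> \<epsilon> \<in> {-1, 1} \<and> \<not> (\<delta> = -1 \<and> \<epsilon> = -1) \<and>
        smooth_on I \<rho> \<and> (\<forall>u\<in>I. \<rho> u > 0) \<and>
        (\<forall>u\<in>I. \<forall>v\<in>J.
           fundform1 X (u, v) (1, 0) (1, 0) = (\<rho> u)\<^sup>2 * \<delta> \<and>
           fundform1 X (u, v) (1, 0) (0, 1) = 0 \<and>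
           fundform1 X (u, v) (0, 1) (0, 1) = (\<rho> u)\<^sup>2 * \<epsilon>))"

section \<open>Weingarten endomorphism, mean curvature, twist\<close>

definition causal_sign :: "(real \<times> real \<Rightarrow> real ^ 3) \<Rightarrow> real \<times> real \<Rightarrow> real" where
  "causal_sign X p = (if spacelike_at X p then 1 else -1)"

definition unit_normal_field ::
  "(real \<times> real) set \<Rightarrow> (real \<times> real \<Rightarrow> real ^ 3) \<Rightarrow> (real \<times> real \<Rightarrow> real ^ 3) \<Rightarrow> bool" where
  "unit_normal_field U X N \<longleftrightarrow> smooth_on U N \<and>
     (\<forall>p\<in>U. (\<forall>w. lorentz (N p) (frechet_derivative X (at p) w) = 0) \<and>
             lorentz (N p) (N p) = - causal_sign X p)"

definition tangential_part :: "real ^ 3 \<Rightarrow> real ^ 3 \<Rightarrow> real ^ 3" where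
  "tangential_part n y = y - (lorentz y n / lorentz n n) *\<^sub>R n"

(* The ambient vector A(dX_p(w)), for w in the coordinate plane. *)
definition weingarten ::
  "(real \<times> real \<Rightarrow> real ^ 3) \<Rightarrow> real \<times> real \<Rightarrow> real \<times> real \<Rightarrow> real ^ 3" where
  "weingarten N p w = - tangential_part (N p) (frechet_derivative N (at p) w)"

(* The columns are the coordinates of the images of the basis vectors. *)
definition weingarten_matrix ::
  "(real \<times> real \<Rightarrow> real ^ 3) \<Rightarrow> (real \<times> real \<Rightarrow> real ^ 3) \<Rightarrow> real \<times> real \<Rightarrow> real ^ 2 ^ 2" where
  "weingarten_matrix X N p = (THE M.
     weingarten N p (1, 0) = M $ 1 $ 1 *\<^sub>R partial_u X p + M $ 2 $ 1 *\<^sub>R partial_v X p \<and>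
     weingarten N p (0, 1) = M $ 1 $ 2 *\<^sub>R partial_u X p + M $ 2 $ 2 *\<^sub>R partial_v X p)"

(* The trace of A is the sum of the principal curvatures when A is diagonalizable, and also
   makes sense on timelike surfaces whose A is not. *)
definition mean_curvature ::
  "(real \<times> real \<Rightarrow> real ^ 3) \<Rightarrow> (real \<times> real \<Rightarrow> real ^ 3) \<Rightarrow> real \<times> real \<Rightarrow> real" where
  "mean_curvature X N p = - causal_sign X p * (trace (weingarten_matrix X N p) / 2)"

(* Replacing N by -N only changes the sign of A, so neither this notion nor the twist
   depends on the choice of N. *)
definition zero_mean_curvature :: "(real \<times> real) set \<Rightarrow> (real \<times> real \<Rightarrow> real ^ 3) \<Rightarrow> bool" where
  "zero_mean_curvature U X \<longleftrightarrow>
     (\<exists>N. unit_normal_field U X N \<and> (\<forall>p\<in>U. mean_curvature X N p = 0))"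

definition rot_mat :: "real \<Rightarrow> real ^ 2 ^ 2" where
  "rot_mat \<theta> = vector [vector [cos \<theta>, - sin \<theta>], vector [sin \<theta>, cos \<theta>]]"

definition boost_mat :: "real \<Rightarrow> real ^ 2 ^ 2" where
  "boost_mat \<theta> = vector [vector [cosh \<theta>, sinh \<theta>], vector [sinh \<theta>, cosh \<theta>]]"

definition diag_mat :: "real \<Rightarrow> real \<Rightarrow> real ^ 2 ^ 2" where
  "diag_mat a b = vector [vector [a, 0], vector [0, b]]"

(* Diagonalizability of A is implied by the displayed form of its matrix. *)
definition has_twist ::
  "real set \<Rightarrow> real set \<Rightarrow> (real \<times> real \<Rightarrow> real ^ 3) \<Rightarrow> (real \<Rightarrow> real) \<Rightarrow> bool" where
  "has_twist I J X \<alpha> \<longleftrightarrow>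
     (\<exists>N. unit_normal_field (I \<times> J) X N \<and>
       (\<exists>\<kappa>\<^sub>1 \<kappa>\<^sub>2 :: real \<Rightarrow> real.
          (spacelike_surface (I \<times> J) X \<and>
           (\<forall>u\<in>I. \<forall>v\<in>J. weingarten_matrix X N (u, v) =
              rot_mat (- \<alpha> v) ** diag_mat (\<kappa>\<^sub>1 u) (\<kappa>\<^sub>2 u) ** rot_mat (\<alpha> v))) \<or>
          (timelike_surface (I \<times> J) X \<and>
           (\<forall>u\<in>I. \<forall>v\<in>J. weingarten_matrix X N (u, v) =
              boost_mat (- \<alpha> v) ** diag_mat (\<kappa>\<^sub>1 u) (\<kappa>\<^sub>2 u) ** boost_mat (\<alpha> v)))))"

section \<open>Associate surfaces\<close>

definition conjugate_map ::
  "(real \<times> real) set \<Rightarrow> (real \<times> real \<Rightarrow> real ^ 3) \<Rightarrow> (real \<times> real \<Rightarrow> real ^ 3) \<Rightarrow> bool" where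
  "conjugate_map U X Z \<longleftrightarrow>
     (\<forall>i. (\<lambda>z. Complex (X (Re z, Im z) $ i) (Z (Re z, Im z) $ i)) holomorphic_on
            {z. (Re z, Im z) \<in> U})"

definition paraconjugate_map ::
  "(real \<times> real) set \<Rightarrow> (real \<times> real \<Rightarrow> real ^ 3) \<Rightarrow> (real \<times> real \<Rightarrow> real ^ 3) \<Rightarrow> bool" where
  "paraconjugate_map U X Z \<longleftrightarrow>
     (\<forall>p\<in>U. Z differentiable (at p) \<and>
        partial_u X p = partial_v Z p \<and> partial_v X p = partial_u Z p)"

(* Y is an associate surface of X. *)
definition associate_surface ::
  "(real \<times> real) set \<Rightarrow> (real \<times> real \<Rightarrow> real ^ 3) \<Rightarrow> (real \<times> real \<Rightarrow> real ^ 3) \<Rightarrow> bool" where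
  "associate_surface U X Y \<longleftrightarrow> zero_mean_curvature U X \<and>
     ((spacelike_surface U X \<and> simply_connected U \<and>
       (\<forall>p\<in>U. fundform1 X p (1, 0) (1, 0) = fundform1 X p (0, 1) (0, 1) \<and>
               fundform1 X p (1, 0) (0, 1) = 0) \<and>
       (\<exists>Z \<theta>. conjugate_map U X Z \<and> (\<forall>p\<in>U. Y p = cos \<theta> *\<^sub>R X p + sin \<theta> *\<^sub>R Z p)))
    \<or> (timelike_surface U X \<and>
       (\<forall>p\<in>U. fundform1 X p (1, 0) (1, 0) = - fundform1 X p (0, 1) (0, 1) \<and>
               fundform1 X p (1, 0) (0, 1) = 0) \<and>
       (\<exists>Z \<theta>. paraconjugate_map U X Z \<and> (\<forall>p\<in>U. Y p = cosh \<theta> *\<^sub>R X p + sinh \<theta> *\<^sub>R Z p))))"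

section \<open>Surfaces of revolution\<close>

(* The derivative of an isometry is invertible, so the inverse map is automatically smooth. *)
definition lorentz_isometry :: "(real ^ 3 \<Rightarrow> real ^ 3) \<Rightarrow> bool" where
  "lorentz_isometry f \<longleftrightarrow> bij f \<and> smooth_on UNIV f \<and>
     (\<forall>p w z. lorentz (frechet_derivative f (at p) w) (frechet_derivative f (at p) z) = lorentz w z)"

definition rotation_group :: "(real \<Rightarrow> real ^ 3 \<Rightarrow> real ^ 3) \<Rightarrow> bool" where
  "rotation_group \<phi> \<longleftrightarrow>
     (\<forall>t. lorentz_isometry (\<phi> t)) \<and>
     \<phi> 0 = id \<and> (\<forall>s t. \<phi> (s + t) = \<phi> s \<circ> \<phi> t) \<and> (\<forall>x. smooth_on UNIV (\<lambda>t. \<phi> t x)) \<and>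
     (\<exists>t. \<phi> t \<noteq> id) \<and>
     (\<exists>a d. d \<noteq> 0 \<and> (\<forall>t r. \<phi> t (a + r *\<^sub>R d) = a + r *\<^sub>R d))"

(* X(U) only has to be contained in the set swept out by the curve: open pieces are allowed,
   and the coordinates (u,v) need not be adapted to the rotations (as for Cartesian
   coordinates on a plane). *)
definition surface_of_revolution :: "(real \<times> real) set \<Rightarrow> (real \<times> real \<Rightarrow> real ^ 3) \<Rightarrow> bool" where
  "surface_of_revolution U X \<longleftrightarrow> nondegenerate_surface U X \<and>
     (\<exists>\<phi> K \<gamma>. rotation_group \<phi> \<and> open_interval K \<and> smooth_on K \<gamma> \<and>
        (\<forall>s\<in>K. vector_derivative \<gamma> (at s) \<noteq> 0) \<and>
        (\<forall>p\<in>U. \<exists>t. \<exists>s\<in>K. X p = \<phi> t (\<gamma> s)))"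

end

theory Submission
  imports Defs
begin

text \<open>A surface \<open>X\<close> of zero mean curvature in isothermal coordinates satisfies the Laplace or the wave
equation, so it has a conjugate or paraconjugate map and an associate family. All members of this
family share the metric and the Gauss map of \<open>X\<close>, while the matrix of the Weingarten endomorphism,
being symmetric and trace-free, turns with the parameter. If \<open>X\<close> has constant twist \<open>c\<close>, this matrix
is a function of \<open>u\<close> times a constant matrix of angle \<open>2 c\<close> (\<open>twisted_traceless_matrix\<close>), and
the member \<open>Y\<close> of the family at parameter \<open>\<plusminus>2 c\<close> has a diagonal matrix. Since the members of the
family arise from \<open>X\<close> and its conjugate by circular or hyperbolic rotation, \<open>X\<close> is in turn an associate of \<open>Y\<close>.

It remains to see that \<open>Y\<close> is a surface of revolution
(\<open>curvature_line_surface.surface_of_revolution\<close>). All coefficients of the structure equations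
of \<open>Y\<close> depend on \<open>u\<close> only, so shifting \<open>v\<close> is the restriction of a one-parameter group of
isometries. Its generator is found directly: diagonality gives \<open>Y\<^sub>v = \<rho>(u) f(v)\<close> with \<open>f'' = m f\<close> for
a constant \<open>m\<close>, so the bivector \<open>f \<and> f'\<close> is constant, and the associated skew map \<open>B\<close> satisfies
\<open>Y\<^sub>v = B (Y - x0)\<close> for a suitable point \<open>x0\<close>. The existence of \<open>x0\<close> is what separates
rotations from screw motions; it holds because \<open>Y\<^sub>v\<close> is a multiple of \<open>f\<close>, which lies in the image
of \<open>B\<close> as soon as \<open>f' \<noteq> 0\<close>. Orbits of \<open>B\<close> are written with
generalized sine and cosine functions that cover all three causal types of axis.

The exceptional case \<open>f' = 0\<close> is that of a plane in affine coordinates, which is swept out by rotations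
about a normal line. For a timelike plane the profile curve has to meet the orbits of the
hyperbolic rotations in all four quadrants, the null lines and the centre; a spiral in null
coordinates does.\<close>

section \<open>Calculus of smooth maps\<close>

text \<open>On an open set a derivative depends on the values of the map near the point only, so it may be
replaced by an explicit formula without leaving the class \<open>C\<^sup>k\<close>.\<close>

lemma Ck_on_cong:
  assumes "open S" "\<And>x. x \<in> S \<Longrightarrow> f x = g x" "Ck_on n S f"
  shows "Ck_on n S g"
  using assms(2,3)
proof (induction n arbitrary: f g)
  case 0
  then show ?case using continuous_on_cong by force
next
  case (Suc n)
  have D: "(g has_derivative frechet_derivative f (at x)) (at x)" if "x \<in> S" for x
  proof -
    have "(f has_derivative frechet_derivative f (at x)) (at x)"
      using Suc.prems(2) that by (auto simp: frechet_derivative_works)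
    then show ?thesis
      using has_derivative_transform_within_open[OF _ \<open>open S\<close> that] Suc.prems(1) by blast
  qed
  have "frechet_derivative f (at x) w = frechet_derivative g (at x) w" if "x \<in> S" for x w
    using frechet_derivative_at[OF D[OF that]] by simp
  then have "Ck_on n S (\<lambda>x. frechet_derivative g (at x) w)" for w
    using Suc.IH[of "\<lambda>x. frechet_derivative f (at x) w"] Suc.prems(2) by simp
  then show ?case using D by (auto simp: differentiable_def)
qed

lemma Ck_on_SucI:
  assumes "open S" "\<And>x. x \<in> S \<Longrightarrow> (f has_derivative f' x) (at x)" "\<And>w. Ck_on n S (\<lambda>x. f' x w)"
  shows "Ck_on (Suc n) S f"
proof -
  have "Ck_on n S (\<lambda>x. frechet_derivative f (at x) w)" for w
  proof (rule Ck_on_cong[OF \<open>open S\<close> _ assms(3)[of w]])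
    show "f' x w = frechet_derivative f (at x) w" if "x \<in> S" for x
      by (rule fun_cong[OF frechet_derivative_at[OF assms(2)[OF that]]])
  qed
  then show ?thesis using assms(2) by (auto simp: differentiable_def)
qed

lemma Ck_on_SucD:
  assumes "Ck_on (Suc n) S f" "x \<in> S"
  shows "(f has_derivative frechet_derivative f (at x)) (at x)"
  using assms by (auto simp: frechet_derivative_works)

lemma Ck_on_const: "open S \<Longrightarrow> Ck_on n S (\<lambda>x. c)"
proof (induction n arbitrary: c)
  case (Suc n)
  show ?case by (rule Ck_on_SucI[where f' = "\<lambda>x w. 0"]) (use Suc in auto)
qed simp

lemma Ck_on_affine:
  assumes "open S" "bounded_linear L"
  shows "Ck_on n S (\<lambda>x. c + L x)"
proof (cases n)
  case 0
  then show ?thesis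
    using bounded_linear.continuous_on[OF assms(2)] by (auto intro!: continuous_intros)
next
  case (Suc m)
  show ?thesis unfolding Suc
    by (rule Ck_on_SucI[where f' = "\<lambda>x. L"])
       (auto intro!: assms(1) Ck_on_const derivative_eq_intros bounded_linear_imp_has_derivative[OF assms(2)])
qed

lemma Ck_on_linear_combination:
  assumes "open S" "Ck_on n S f" "Ck_on n S g"
  shows "Ck_on n S (\<lambda>x. a *\<^sub>R f x + b *\<^sub>R g x)"
  using assms(2,3)
proof (induction n arbitrary: f g)
  case 0
  then show ?case by (auto intro!: continuous_intros)
next
  case (Suc n)
  show ?case
    by (rule Ck_on_SucI[OF \<open>open S\<close>, where f' = "\<lambda>x w. a *\<^sub>R frechet_derivative f (at x) w + b *\<^sub>R frechet_derivative g (at x) w"])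
       (use Suc in \<open>auto intro!: derivative_intros Ck_on_SucD\<close>)
qed

lemma smooth_on_linear_combination:
  "open S \<Longrightarrow> smooth_on S f \<Longrightarrow> smooth_on S g \<Longrightarrow> smooth_on S (\<lambda>x. a *\<^sub>R f x + b *\<^sub>R g x)"
  unfolding smooth_on_def using Ck_on_linear_combination by blast

lemma smooth_on_has_derivative:
  "smooth_on S f \<Longrightarrow> x \<in> S \<Longrightarrow> (f has_derivative frechet_derivative f (at x)) (at x)"
  unfolding smooth_on_def by (rule Ck_on_SucD[of 0]) auto

lemma smooth_on_frechet_derivative:
  "smooth_on S f \<Longrightarrow> smooth_on S (\<lambda>x. frechet_derivative f (at x) w)"
  unfolding smooth_on_def
proof
  fix n assume "\<forall>n. Ck_on n S f"
  then have "Ck_on (Suc n) S f" by (rule spec)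
  then show "Ck_on n S (\<lambda>x. frechet_derivative f (at x) w)" by simp
qed

lemma smooth_on_continuous_on: "smooth_on S f \<Longrightarrow> continuous_on S f"
  unfolding smooth_on_def by (drule spec[of _ 0]) simp

lemma smooth_on_of_derivative:
  assumes "open S" "\<And>x. x \<in> S \<Longrightarrow> (f has_derivative f' x) (at x)" "\<And>w. smooth_on S (\<lambda>x. f' x w)"
  shows "smooth_on S f"
  unfolding smooth_on_def
proof
  fix n
  show "Ck_on n S f"
  proof (cases n)
    case 0
    have "continuous_on S f"
      using assms(2) has_derivative_continuous continuous_at_imp_continuous_on by blast
    then show ?thesis using 0 by simp
  next
    case (Suc m)
    show ?thesis unfolding Suc
    proof (rule Ck_on_SucI[OF assms(1,2)])
      show "Ck_on m S (\<lambda>x. f' x w)" for w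
        using assms(3)[of w] unfolding smooth_on_def by (rule spec)
    qed
  qed
qed

text \<open>A family of curves that is closed under differentiation and scaling consists of smooth curves.
This applies to orbits of one-parameter groups, where differentiation acts on the initial point,
and to the spiral \<open>(s cos s, s sin s)\<close>. Closure under scaling is demanded because the derivative in
direction \<open>w\<close> of a curve is \<open>w\<close> times its velocity.\<close>

lemma smooth_on_curve_family:
  fixes F :: "'i \<Rightarrow> real \<Rightarrow> 'b::euclidean_space"
  assumes "open K" "\<And>i s. s \<in> K \<Longrightarrow> (F i has_vector_derivative F (d i) s) (at s)"
    and scale: "\<And>i r. \<exists>j. \<forall>s\<in>K. r *\<^sub>R F i s = F j s"
  shows "smooth_on K (F i)"
  unfolding smooth_on_def
proof
  fix n show "Ck_on n K (F i)"
  proof (induction n arbitrary: i)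
    case 0
    have "continuous_on K (F i)"
      using assms(2) has_vector_derivative_continuous continuous_at_imp_continuous_on by blast
    then show ?case by simp
  next
    case (Suc n)
    show ?case
    proof (rule Ck_on_SucI[OF \<open>open K\<close>, where f' = "\<lambda>s w. w *\<^sub>R F (d i) s"])
      show "(F i has_derivative (\<lambda>w. w *\<^sub>R F (d i) s)) (at s)" if "s \<in> K" for s
        using assms(2)[OF that] by (simp add: has_vector_derivative_def)
      show "Ck_on n K (\<lambda>s. w *\<^sub>R F (d i) s)" for w
      proof -
        obtain j where j: "\<forall>s\<in>K. w *\<^sub>R F (d i) s = F j s" using scale by blast
        show ?thesis
          by (rule Ck_on_cong[OF \<open>open K\<close> _ Suc.IH[of j]]) (use j in auto)
      qed
    qed
  qed
qed

lemma smooth_on_slice: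
  fixes F :: "real \<times> real \<Rightarrow> 'b::euclidean_space"
  assumes "open I" "smooth_on (I \<times> J) F" "v \<in> J"
  shows "smooth_on I (\<lambda>u. F (u, v))"
  unfolding smooth_on_def
proof
  fix n
  have "Ck_on n (I \<times> J) F" using assms(2) by (simp add: smooth_on_def)
  then show "Ck_on n I (\<lambda>u. F (u, v))"
  proof (induction n arbitrary: F)
    case 0
    then show ?case
      using \<open>v \<in> J\<close> by (auto intro!: continuous_on_compose2[of "I \<times> J" F I "\<lambda>u. (u, v)"] continuous_intros)
  next
    case (Suc n)
    show ?case
    proof (rule Ck_on_SucI[OF \<open>open I\<close>, where f' = "\<lambda>u w. frechet_derivative F (at (u, v)) (w, 0)"])
      fix u assume "u \<in> I"
      then have "(F has_derivative frechet_derivative F (at (u, v))) (at (u, v))"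
        using Ck_on_SucD[OF Suc.prems] \<open>v \<in> J\<close> by blast
      then have "(F \<circ> (\<lambda>u. (u, v)) has_derivative frechet_derivative F (at (u, v)) \<circ> (\<lambda>w. (w, 0))) (at u)"
        by (intro diff_chain_at) (auto intro!: derivative_eq_intros)
      then show "((\<lambda>u. F (u, v)) has_derivative (\<lambda>w. frechet_derivative F (at (u, v)) (w, 0))) (at u)"
        by (simp add: o_def)
    next
      fix w
      show "Ck_on n I (\<lambda>u. frechet_derivative F (at (u, v)) (w, 0))"
        using Suc.IH[of "\<lambda>p. frechet_derivative F (at p) (w, 0)"] Suc.prems by simp
    qed
  qed
qed

lemma partial_u_slice:
  assumes "(F has_derivative frechet_derivative F (at (u, v))) (at (u, v))"
  shows "((\<lambda>u. F (u, v)) has_vector_derivative partial_u F (u, v)) (at u)"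
  unfolding has_vector_derivative_def
proof (rule has_derivative_eq_rhs)
  have "(F \<circ> (\<lambda>u. (u, v)) has_derivative frechet_derivative F (at (u, v)) \<circ> (\<lambda>w. (w, 0))) (at u)"
    by (intro diff_chain_at assms) (auto intro!: derivative_eq_intros)
  then show "((\<lambda>u. F (u, v)) has_derivative (\<lambda>w. frechet_derivative F (at (u, v)) (w, 0))) (at u)"
    by (simp add: o_def)
  have "frechet_derivative F (at (u, v)) (w, 0) = w *\<^sub>R partial_u F (u, v)" for w
    using linear_scale[OF has_derivative_linear[OF assms], of w "(1, 0)"] by simp
  then show "(\<lambda>w. frechet_derivative F (at (u, v)) (w, 0)) = (\<lambda>w. w *\<^sub>R partial_u F (u, v))"
    by (intro ext)
qed

lemma partial_v_slice:
  assumes "(F has_derivative frechet_derivative F (at (u, v))) (at (u, v))"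
  shows "((\<lambda>v. F (u, v)) has_vector_derivative partial_v F (u, v)) (at v)"
  unfolding has_vector_derivative_def
proof (rule has_derivative_eq_rhs)
  have "(F \<circ> (\<lambda>v. (u, v)) has_derivative frechet_derivative F (at (u, v)) \<circ> (\<lambda>w. (0, w))) (at v)"
    by (intro diff_chain_at assms) (auto intro!: derivative_eq_intros)
  then show "((\<lambda>v. F (u, v)) has_derivative (\<lambda>w. frechet_derivative F (at (u, v)) (0, w))) (at v)"
    by (simp add: o_def)
  have "frechet_derivative F (at (u, v)) (0, w) = w *\<^sub>R partial_v F (u, v)" for w
    using linear_scale[OF has_derivative_linear[OF assms], of w "(0, 1)"] by simp
  then show "(\<lambda>w. frechet_derivative F (at (u, v)) (0, w)) = (\<lambda>w. w *\<^sub>R partial_v F (u, v))"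
    by (intro ext)
qed

lemma derivative_by_partials:
  assumes "linear D"
  shows "D w = fst w *\<^sub>R D (1::real, 0::real) + snd w *\<^sub>R D (0, 1)"
proof -
  have "w = fst w *\<^sub>R (1, 0) + snd w *\<^sub>R (0, 1)" by (simp add: prod_eq_iff)
  then have "D w = D (fst w *\<^sub>R (1, 0) + snd w *\<^sub>R (0, 1))" by (rule arg_cong)
  also have "\<dots> = D (fst w *\<^sub>R (1, 0)) + D (snd w *\<^sub>R (0, 1))" by (rule linear_add[OF assms])
  also have "\<dots> = fst w *\<^sub>R D (1, 0) + snd w *\<^sub>R D (0, 1)"
    by (intro arg_cong2[where f = "(+)"] linear_scale[OF assms])
  finally show ?thesis .
qed

lemma smooth_on_partials:
  assumes "smooth_on S F" "(u, v) \<in> S"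
  shows "((\<lambda>u. F (u, v)) has_vector_derivative partial_u F (u, v)) (at u within T)"
    and "((\<lambda>v. F (u, v)) has_vector_derivative partial_v F (u, v)) (at v within T)"
  using partial_u_slice[OF smooth_on_has_derivative[OF assms]]
    partial_v_slice[OF smooth_on_has_derivative[OF assms]]
  by (blast intro: has_vector_derivative_at_within)+

text \<open>Schwarz's theorem. The increment of \<open>F\<close> in \<open>u\<close> is the integral of its \<open>u\<close>-derivative; differentiating
this identity in \<open>v\<close> under the integral sign, and then in \<open>u\<close>, gives the claim.\<close>

lemma mixed_partials_eq:
  fixes F :: "real \<times> real \<Rightarrow> 'b::euclidean_space"
  assumes "open I" "is_interval I" "open J" "is_interval J" and F: "smooth_on (I \<times> J) F"
    and u: "u \<in> I" and v: "v \<in> J"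
  shows "partial_v (partial_u F) (u, v) = partial_u (partial_v F) (u, v)"
proof -
  let ?Fu = "partial_u F" and ?Fv = "partial_v F"
  let ?Fuv = "partial_v ?Fu"
  have Fu: "smooth_on (I \<times> J) ?Fu" and Fv: "smooth_on (I \<times> J) ?Fv"
    using F smooth_on_frechet_derivative by blast+
  have Fuv: "smooth_on (I \<times> J) ?Fuv" using Fu smooth_on_frechet_derivative by blast
  obtain d where "d > 0" and d: "cball u d \<subseteq> I"
    using \<open>open I\<close> u open_contains_cball by blast
  define a where "a = u - d"
  define b where "b = u + d"
  have ab: "{a..b} \<subseteq> I" "a < u" "u < b" using d \<open>d > 0\<close> by (auto simp: a_def b_def cball_eq_atLeastAtMost)
  have slice: "continuous_on {a..x} (\<lambda>t. G (t, y))"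
    if "x \<le> b" "y \<in> J" "continuous_on (I \<times> J) G" for x y and G :: "real \<times> real \<Rightarrow> 'b"
    by (rule continuous_on_compose2[OF that(3)]) (use that ab in \<open>auto intro!: continuous_intros\<close>)
  have incr: "integral {a..x} (\<lambda>t. ?Fuv (t, v)) = ?Fv (x, v) - ?Fv (a, v)" if x: "x \<in> {a..b}" for x
  proof -
    have FTC: "integral {a..x} (\<lambda>t. ?Fu (t, y)) = F (x, y) - F (a, y)" if "y \<in> J" for y
    proof (rule integral_unique, rule fundamental_theorem_of_calculus)
      show "((\<lambda>t. F (t, y)) has_vector_derivative ?Fu (t, y)) (at t within {a..x})" if "t \<in> {a..x}" for t
        using that x ab \<open>y \<in> J\<close>
        by (intro smooth_on_partials(1)[OF F]) auto
    qed (use x in auto)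
    have "((\<lambda>y. integral (cbox a x) (\<lambda>t. ?Fu (t, y))) has_vector_derivative
             integral (cbox a x) (\<lambda>t. ?Fuv (t, v))) (at v within J)"
    proof (rule leibniz_rule_vector_derivative)
      show "((\<lambda>y. ?Fu (t, y)) has_vector_derivative ?Fuv (t, y)) (at y within J)"
        if "y \<in> J" "t \<in> cbox a x" for y t
        using that x ab
        by (intro smooth_on_partials(2)[OF Fu]) auto
      show "(\<lambda>t. ?Fu (t, y)) integrable_on cbox a x" if "y \<in> J" for y
        using slice[OF _ that smooth_on_continuous_on[OF Fu]] x by (intro integrable_continuous) auto
      have "continuous_on (J \<times> cbox a x) (\<lambda>z. ?Fuv (snd z, fst z))"
        by (rule continuous_on_compose2[OF smooth_on_continuous_on[OF Fuv]])
           (use x ab in \<open>auto intro!: continuous_intros\<close>)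
      then show "continuous_on (J \<times> cbox a x) (\<lambda>(y, t). ?Fuv (t, y))" by (simp add: split_beta)
    qed (use v assms is_interval_convex in auto)
    then have "((\<lambda>y. integral {a..x} (\<lambda>t. ?Fu (t, y))) has_vector_derivative
             integral {a..x} (\<lambda>t. ?Fuv (t, v))) (at v)"
      using at_within_open[OF v \<open>open J\<close>] by simp
    then have 1: "((\<lambda>y. F (x, y) - F (a, y)) has_vector_derivative
             integral {a..x} (\<lambda>t. ?Fuv (t, v))) (at v)"
      by (rule has_vector_derivative_transform_within_open[OF _ \<open>open J\<close> v]) (rule FTC)
    have "((\<lambda>y. F (x, y) - F (a, y)) has_vector_derivative ?Fv (x, v) - ?Fv (a, v)) (at v)"
      by (intro has_vector_derivative_diff smooth_on_partials(2)[OF F]) (use x ab v in auto)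
    then show ?thesis using vector_derivative_unique_at[OF 1] by blast
  qed
  have "((\<lambda>x. integral {a..x} (\<lambda>t. ?Fuv (t, v))) has_vector_derivative ?Fuv (u, v)) (at u within {a..b})"
    by (rule integral_has_vector_derivative)
       (use slice[OF _ v smooth_on_continuous_on[OF Fuv]] ab in auto)
  then have "((\<lambda>x. integral {a..x} (\<lambda>t. ?Fuv (t, v))) has_vector_derivative ?Fuv (u, v)) (at u)"
    using at_within_Icc_at[OF ab(2,3)] by simp
  then have "((\<lambda>x. ?Fv (x, v) - ?Fv (a, v)) has_vector_derivative ?Fuv (u, v)) (at u)"
    by (rule has_vector_derivative_transform_within_open[of _ _ _ "{a<..<b}"])
       (use ab incr in auto)
  moreover have "((\<lambda>x. ?Fv (x, v) - ?Fv (a, v)) has_vector_derivative partial_u ?Fv (u, v) - 0) (at u)"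
    by (intro has_vector_derivative_diff has_vector_derivative_const smooth_on_partials(1)[OF Fv]) (use u v in auto)
  ultimately show ?thesis using vector_derivative_unique_at by fastforce
qed

text \<open>Poincare's lemma for the closed form \<open>P du + Q dv\<close>: integrate the form along the segments from a
fixed base point. It yields the conjugate and paraconjugate maps, whose integrability conditions
are the Laplace and the wave equation.\<close>

lemma closed_form_has_primitive:
  fixes P Q :: "real \<times> real \<Rightarrow> 'b::euclidean_space"
  assumes "open S" "convex S" and P: "smooth_on S P" and Q: "smooth_on S Q"
    and closed: "\<And>p. p \<in> S \<Longrightarrow> partial_v P p = partial_u Q p"
  obtains Z where "\<And>p. p \<in> S \<Longrightarrow> (Z has_derivative (\<lambda>w. fst w *\<^sub>R P p + snd w *\<^sub>R Q p)) (at p)"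
proof (cases "S = {}")
  case False
  then obtain p0 where p0: "p0 \<in> S" by blast
  define \<gamma> where "\<gamma> p s = p0 + s *\<^sub>R (p - p0)" for p :: "real \<times> real" and s :: real
  have \<gamma>: "\<gamma> p s \<in> S" if "p \<in> S" "s \<in> {0..1}" for p s
  proof -
    have "(1 - s) *\<^sub>R p0 + s *\<^sub>R p \<in> S" using convexD_alt[OF \<open>convex S\<close> p0] that by auto
    then show ?thesis by (simp add: \<gamma>_def algebra_simps)
  qed
  let ?P' = "\<lambda>p. frechet_derivative P (at p)" and ?Q' = "\<lambda>p. frechet_derivative Q (at p)"
  define f where "f p s = fst (p - p0) *\<^sub>R P (\<gamma> p s) + snd (p - p0) *\<^sub>R Q (\<gamma> p s)" for p s
  define D where "D p s w = (fst w *\<^sub>R P (\<gamma> p s) + snd w *\<^sub>R Q (\<gamma> p s)) +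
      s *\<^sub>R (fst (p - p0) *\<^sub>R ?P' (\<gamma> p s) w + snd (p - p0) *\<^sub>R ?Q' (\<gamma> p s) w)" for p s w
  define Z where "Z p = integral (cbox 0 1) (f p)" for p
  have cont: "continuous_on (S \<times> cbox 0 1) (\<lambda>x. G (\<gamma> (fst x) (snd x)))"
    if "continuous_on S G" for G :: "real \<times> real \<Rightarrow> 'b"
    by (rule continuous_on_compose2[OF that])
       (use \<gamma> in \<open>auto simp: \<gamma>_def intro!: continuous_intros\<close>)
  have G': "((\<lambda>p. G (\<gamma> p s)) has_derivative (\<lambda>w. s *\<^sub>R frechet_derivative G (at (\<gamma> p s)) w)) (at p)"
    if G: "smooth_on S G" and ps: "p \<in> S" "s \<in> {0..1}" for G :: "real \<times> real \<Rightarrow> 'b" and p s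
  proof -
    note dG = smooth_on_has_derivative[OF G \<gamma>[OF ps]]
    have "((\<lambda>p. \<gamma> p s) has_derivative (\<lambda>w. s *\<^sub>R w)) (at p)"
      unfolding \<gamma>_def by (auto intro!: derivative_eq_intros)
    from diff_chain_at[OF this dG]
    have "((\<lambda>p. G (\<gamma> p s)) has_derivative (\<lambda>w. frechet_derivative G (at (\<gamma> p s)) (s *\<^sub>R w))) (at p)"
      by (simp add: o_def)
    then show ?thesis
      by (rule has_derivative_eq_rhs) (intro ext linear_scale[OF has_derivative_linear[OF dG]])
  qed
  have f': "((\<lambda>p. f p s) has_derivative D p s) (at p)" if ps: "p \<in> S" "s \<in> {0..1}" for p s
    unfolding f_def D_def
    by (rule has_derivative_eq_rhs, (rule derivative_intros G'[OF P ps] G'[OF Q ps])+)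
       (auto simp: algebra_simps fun_eq_iff)
  have blD: "blinfun_apply (Blinfun (D p s)) = D p s" if "p \<in> S" "s \<in> {0..1}" for p s
    using f'[OF that] has_derivative_bounded_linear bounded_linear_Blinfun_apply by blast
  have contD: "continuous_on (S \<times> cbox 0 1) (\<lambda>x. D (fst x) (snd x) w)" for w
    unfolding D_def
    by (intro continuous_intros cont smooth_on_continuous_on P Q smooth_on_frechet_derivative)
  have contBD: "continuous_on (S \<times> cbox 0 1) (\<lambda>(p, s). Blinfun (D p s))"
  proof (rule continuous_on_blinfun_componentwise)
    fix i
    show "continuous_on (S \<times> cbox 0 1) (\<lambda>x. blinfun_apply (case x of (p, s) \<Rightarrow> Blinfun (D p s)) i)"
      by (rule continuous_on_eq[OF contD[of i]]) (use blD in auto)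
  qed
  have "(Z has_derivative (\<lambda>w. fst w *\<^sub>R P p + snd w *\<^sub>R Q p)) (at p)" if p: "p \<in> S" for p
  proof -
    have "((\<lambda>p. integral (cbox 0 1) (f p)) has_derivative
        blinfun_apply (integral (cbox 0 1) (\<lambda>s. Blinfun (D p s)))) (at p within S)"
    proof (rule leibniz_rule)
      show "((\<lambda>p. f p s) has_derivative blinfun_apply (Blinfun (D p s))) (at p within S)"
        if "p \<in> S" "s \<in> cbox 0 1" for p s
        using f'[of p s] blD[of p s] that by (auto intro: has_derivative_at_withinI)
      show "f p integrable_on cbox 0 1" if "p \<in> S" for p
      proof (rule integrable_continuous)
        have "continuous_on (cbox 0 1) (\<lambda>s. G (\<gamma> p s))" if "continuous_on S G" for G :: "real \<times> real \<Rightarrow> 'b"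
          by (rule continuous_on_compose2[OF that])
             (use \<gamma>[OF \<open>p \<in> S\<close>] in \<open>auto simp: \<gamma>_def image_subset_iff intro!: continuous_intros\<close>)
        then show "continuous_on (cbox 0 1) (f p)"
          unfolding f_def by (intro continuous_intros) (use P Q smooth_on_continuous_on in blast)+
      qed
    qed (use contBD p \<open>convex S\<close> in auto)
    then have dZ: "(Z has_derivative blinfun_apply (integral (cbox 0 1) (\<lambda>s. Blinfun (D p s)))) (at p)"
      using at_within_open[OF p \<open>open S\<close>] by (simp add: Z_def[abs_def])
    have intBD: "(\<lambda>s. Blinfun (D p s)) integrable_on cbox 0 1"
      by (intro integrable_continuous continuous_on_compose2[OF contBD, of _ "\<lambda>s. (p, s)", simplified])
         (use p in \<open>auto intro!: continuous_intros\<close>)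
    \<comment> \<open>By closedness the integrand \<open>D p s w\<close> is the derivative of \<open>s\<close> times the form at
        \<open>\<gamma> p s\<close> applied to \<open>w\<close>, so that the integral telescopes to the form at \<open>p\<close>.\<close>
    have "blinfun_apply (integral (cbox 0 1) (\<lambda>s. Blinfun (D p s))) w = fst w *\<^sub>R P p + snd w *\<^sub>R Q p" for w
    proof -
      have "blinfun_apply (integral (cbox 0 1) (\<lambda>s. Blinfun (D p s))) w
          = integral (cbox 0 1) (\<lambda>s. blinfun_apply (Blinfun (D p s)) w)"
        using blinfun_apply_integral[OF intBD] by simp
      also have "\<dots> = integral (cbox 0 1) (\<lambda>s. D p s w)"
        by (rule integral_cong) (use blD[OF p] in auto)
      also have "\<dots> = integral {0..1} (\<lambda>s. D p s w)"
        by (simp add: cbox_interval)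
      also have "\<dots> = 1 *\<^sub>R (fst w *\<^sub>R P (\<gamma> p 1) + snd w *\<^sub>R Q (\<gamma> p 1)) - 0 *\<^sub>R (fst w *\<^sub>R P (\<gamma> p 0) + snd w *\<^sub>R Q (\<gamma> p 0))"
      proof (rule integral_unique, rule fundamental_theorem_of_calculus)
        fix s :: real assume s: "s \<in> {0..1}"
        have G'': "((\<lambda>s. G (\<gamma> p s)) has_vector_derivative frechet_derivative G (at (\<gamma> p s)) (p - p0)) (at s within {0..1})"
          if G: "smooth_on S G" for G :: "real \<times> real \<Rightarrow> 'b"
        proof -
          note dG = smooth_on_has_derivative[OF G \<gamma>[OF p s]]
          have "(\<gamma> p has_vector_derivative (p - p0)) (at s within {0..1})"
            unfolding \<gamma>_def by (auto intro!: derivative_eq_intros)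
          from vector_derivative_diff_chain_within[OF this has_derivative_at_withinI[OF dG]]
          show ?thesis by (simp add: o_def)
        qed
        have byp: "frechet_derivative G (at (\<gamma> p s)) w = fst w *\<^sub>R partial_u G (\<gamma> p s) + snd w *\<^sub>R partial_v G (\<gamma> p s)"
          if G: "smooth_on S G" for G :: "real \<times> real \<Rightarrow> 'b" and w
          using derivative_by_partials[OF has_derivative_linear[OF smooth_on_has_derivative[OF G \<gamma>[OF p s]]]] .
        let ?E = "s *\<^sub>R (fst w *\<^sub>R ?P' (\<gamma> p s) (p - p0) + snd w *\<^sub>R ?Q' (\<gamma> p s) (p - p0))
              + 1 *\<^sub>R (fst w *\<^sub>R P (\<gamma> p s) + snd w *\<^sub>R Q (\<gamma> p s))"
        have "((\<lambda>s. s *\<^sub>R (fst w *\<^sub>R P (\<gamma> p s) + snd w *\<^sub>R Q (\<gamma> p s))) has_vector_derivative ?E) (at s within {0..1})"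
          by (rule has_vector_derivative_scaleR) (auto intro!: derivative_eq_intros G''[OF P] G''[OF Q])
        moreover have "?E = D p s w"
          unfolding D_def byp[OF P, of w] byp[OF Q, of w] byp[OF P, of "p - p0"] byp[OF Q, of "p - p0"]
            closed[OF \<gamma>[OF p s]]
          by (simp add: algebra_simps)
        ultimately show "((\<lambda>s. s *\<^sub>R (fst w *\<^sub>R P (\<gamma> p s) + snd w *\<^sub>R Q (\<gamma> p s))) has_vector_derivative D p s w) (at s within {0..1})"
          by simp
      qed simp
      finally show ?thesis by (simp add: \<gamma>_def)
    qed
    then show ?thesis by (intro has_derivative_eq_rhs[OF dZ] ext)
  qed
  then show ?thesis using that by blast
qed (use that in blast)

section \<open>Lorentzian linear algebra\<close>

lemma bounded_bilinear_lorentz: "bounded_bilinear lorentz"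
proof -
  have "bilinear lorentz"
    by (auto simp: bilinear_def lorentz_def algebra_simps intro!: linearI)
  then show ?thesis by (rule bilinear_conv_bounded_bilinear[THEN iffD1])
qed

interpretation lorentz: bounded_bilinear lorentz
  by (rule bounded_bilinear_lorentz)

lemma lorentz_commute: "lorentz x y = lorentz y x"
  by (simp add: lorentz_def)

lemmas lorentz_simps =
  lorentz.add_left lorentz.add_right lorentz.diff_left lorentz.diff_right
  lorentz.scaleR_left lorentz.scaleR_right lorentz.minus_left lorentz.minus_right
  lorentz.zero_left lorentz.zero_right

lemma lorentz_nondegenerate:
  assumes "\<And>y. lorentz x y = 0"
  shows "x = 0"
  using assms[of "axis 1 1"] assms[of "axis 2 1"] assms[of "axis 3 1"]
  by (simp add: lorentz_def axis_def vec_eq_iff forall_3)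

text \<open>Three pairwise orthogonal vectors, none of them null, form a basis. All vector identities for a
non-degenerate surface are checked against the frame of the two partial derivatives and the normal.\<close>

lemma orthogonal_frame_eqI:
  assumes "lorentz a a \<noteq> 0" "lorentz b b \<noteq> 0" "lorentz n n \<noteq> 0"
    and "lorentz a b = 0" "lorentz n a = 0" "lorentz n b = 0"
    and "lorentz x a = lorentz y a" "lorentz x b = lorentz y b" "lorentz x n = lorentz y n"
  shows "x = y"
proof -
  define T :: "real ^ 3 \<Rightarrow> real ^ 3" where "T x = vector [lorentz x a, lorentz x b, lorentz x n]" for x
  have T: "linear T"
    by (auto simp: T_def lorentz_simps vec_eq_iff forall_3 vector_3 intro!: linearI)
  have "surj T"
  proof (rule surjI)
    fix c :: "real ^ 3"
    show "T ((c $ 1 / lorentz a a) *\<^sub>R a + (c $ 2 / lorentz b b) *\<^sub>R b + (c $ 3 / lorentz n n) *\<^sub>R n) = c"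
      using assms lorentz_commute[of a b] lorentz_commute[of a n] lorentz_commute[of b n]
      by (simp add: T_def lorentz_simps vec_eq_iff forall_3 vector_3)
  qed
  then have "inj T" using linear_surjective_imp_injective[OF T] by simp
  moreover have "T x = T y" using assms by (simp add: T_def)
  ultimately show ?thesis by (simp add: inj_eq)
qed

lemma exists_orthogonal_to_pair: "\<exists>d. d \<noteq> 0 \<and> lorentz f d = 0 \<and> lorentz g d = 0"
proof -
  define r :: "real ^ 3 \<Rightarrow> real ^ 3" where "r x = vector [x $ 1, x $ 2, - (x $ 3)]" for x
  have r: "inner d (r x) = lorentz x d" for x d
    by (simp add: r_def lorentz_def inner_vec_def sum_3 vector_3 mult.commute)
  have "dim {r f, r g} \<le> card {r f, r g}" by (rule dim_le_card') simp
  also have "\<dots> < DIM(real ^ 3)" by (simp add: card_insert_if)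
  finally obtain d where "d \<noteq> 0" "\<And>y. y \<in> span {r f, r g} \<Longrightarrow> orthogonal d y"
    using orthogonal_to_subspace_exists by blast
  then show ?thesis
    using r by (metis orthogonal_def span_base insertI1 insertI2)
qed

section \<open>One-parameter groups of rotations\<close>

text \<open>The bivector \<open>f \<and> g\<close>, seen through the metric as an infinitesimal rotation.\<close>

definition wedge :: "real ^ 3 \<Rightarrow> real ^ 3 \<Rightarrow> real ^ 3 \<Rightarrow> real ^ 3" where
  "wedge f g x = lorentz f x *\<^sub>R g - lorentz g x *\<^sub>R f"

lemma bounded_linear_wedge: "bounded_linear (wedge f g)"
  unfolding wedge_def
  by (intro bounded_linear_sub bounded_linear_scaleR_left[THEN bounded_linear_compose]
      lorentz.bounded_linear_right)

lemmas wedge_add = linear_add[OF bounded_linear.linear[OF bounded_linear_wedge]]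
lemmas wedge_diff = linear_diff[OF bounded_linear.linear[OF bounded_linear_wedge]]
lemmas wedge_scaleR = linear_scale[OF bounded_linear.linear[OF bounded_linear_wedge]]
lemmas wedge_minus = linear_neg[OF bounded_linear.linear[OF bounded_linear_wedge]]
lemmas wedge_zero = linear_0[OF bounded_linear.linear[OF bounded_linear_wedge]]

lemma wedge_skew: "lorentz (wedge f g x) y = - lorentz x (wedge f g y)"
  by (simp add: wedge_def lorentz_simps lorentz_commute)

text \<open>For orthogonal \<open>f\<close> and \<open>g\<close> the third power of the generator is a multiple of the generator, so its
exponential series collapses to a quadratic expression. The sign of the multiple distinguishes
rotations about a spacelike, timelike or lightlike axis.\<close>

lemma wedge_cube:
  assumes "lorentz f g = 0"
  shows "wedge f g (wedge f g (wedge f g x)) = - (lorentz f f * lorentz g g) *\<^sub>R wedge f g x"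
  using assms lorentz_commute[of g f]
  by (simp add: wedge_def lorentz_simps algebra_simps)

text \<open>\<open>gsin k\<close> is the solution of \<open>y'' = k y\<close> with \<open>y(0) = 0\<close> and \<open>y'(0) = 1\<close>, and \<open>gver k\<close> is its
primitive vanishing at \<open>0\<close>. They treat the three types of axis uniformly.\<close>

definition gsin :: "real \<Rightarrow> real \<Rightarrow> real" where
  "gsin k t = (if k > 0 then sinh (sqrt k * t) / sqrt k
    else if k < 0 then sin (sqrt (- k) * t) / sqrt (- k) else t)"

definition gver :: "real \<Rightarrow> real \<Rightarrow> real" where
  "gver k t = (if k > 0 then (cosh (sqrt k * t) - 1) / k
    else if k < 0 then (cos (sqrt (- k) * t) - 1) / k else t\<^sup>2 / 2)"

lemma gsin_0 [simp]: "gsin k 0 = 0" and gver_0 [simp]: "gver k 0 = 0"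
  by (simp_all add: gsin_def gver_def)

lemma gsin_gver_pos:
  assumes "r > 0"
  shows "gsin (r\<^sup>2) = (\<lambda>t. sinh (r * t) / r)" "gver (r\<^sup>2) = (\<lambda>t. (cosh (r * t) - 1) / r\<^sup>2)"
  using assms by (auto simp: gsin_def gver_def fun_eq_iff)

lemma gsin_gver_neg:
  assumes "r > 0"
  shows "gsin (- r\<^sup>2) = (\<lambda>t. sin (r * t) / r)" "gver (- r\<^sup>2) = (\<lambda>t. (1 - cos (r * t)) / r\<^sup>2)"
  using assms by (auto simp: gsin_def gver_def fun_eq_iff field_simps)

lemma gsin_gver_zero: "gsin 0 = (\<lambda>t. t)" "gver 0 = (\<lambda>t. t\<^sup>2 / 2)"
  by (auto simp: gsin_def gver_def fun_eq_iff)

lemma real_sign_square_cases: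
  obtains (pos) r :: real where "r > 0" "k = r\<^sup>2" | (neg) r where "r > 0" "k = - r\<^sup>2" | (zero) "k = 0"
proof -
  consider "k > 0" | "k < 0" | "k = 0" by linarith
  then show ?thesis
    by cases (use that(1)[of "sqrt k"] that(2)[of "sqrt (- k)"] that(3) in auto)
qed

lemma has_real_derivative_gver: "(gver k has_real_derivative gsin k t) (at t)"
  by (cases k rule: real_sign_square_cases; simp add: gsin_gver_pos gsin_gver_neg gsin_gver_zero)
     (auto simp: power2_eq_square intro!: derivative_eq_intros)

lemma has_real_derivative_gsin: "(gsin k has_real_derivative 1 + k * gver k t) (at t)"
  by (cases k rule: real_sign_square_cases)
     (auto simp: gsin_gver_pos gsin_gver_neg gsin_gver_zero intro!: derivative_eq_intros)

text \<open>The exponential of \<open>t\<close> times \<open>wedge f g\<close>, for orthogonal \<open>f\<close> and \<open>g\<close>.\<close>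

definition rot :: "real ^ 3 \<Rightarrow> real ^ 3 \<Rightarrow> real \<Rightarrow> real ^ 3 \<Rightarrow> real ^ 3" where
  "rot f g t x = (let k = - (lorentz f f * lorentz g g) in
     x + gsin k t *\<^sub>R wedge f g x + gver k t *\<^sub>R wedge f g (wedge f g x))"

lemma bounded_linear_rot: "bounded_linear (rot f g t)"
  unfolding rot_def Let_def
  by (intro bounded_linear_add bounded_linear_ident bounded_linear_const_scaleR
      bounded_linear_wedge bounded_linear_compose[OF bounded_linear_wedge bounded_linear_wedge])

lemmas rot_add = linear_add[OF bounded_linear.linear[OF bounded_linear_rot]]
lemmas rot_diff = linear_diff[OF bounded_linear.linear[OF bounded_linear_rot]]
lemmas rot_scaleR = linear_scale[OF bounded_linear.linear[OF bounded_linear_rot]]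
lemmas rot_zero = linear_0[OF bounded_linear.linear[OF bounded_linear_rot]]

lemma rot_0 [simp]: "rot f g 0 x = x"
  by (simp add: rot_def)

text \<open>The derivative rule from which the group law, the invariance of the metric and the uniqueness of
integral curves follow, each by exhibiting a curve with zero derivative.\<close>

lemma has_vector_derivative_rot:
  assumes "lorentz f g = 0"
    and a: "(a has_real_derivative a') (at v)" and y: "(y has_vector_derivative y') (at v)"
  shows "((\<lambda>v. rot f g (a v) (y v)) has_vector_derivative
     rot f g (a v) (y' + a' *\<^sub>R wedge f g (y v))) (at v)"
proof -
  let ?k = "- (lorentz f f * lorentz g g)"
  have By: "((\<lambda>v. wedge f g (y v)) has_vector_derivative wedge f g y') (at v)"
    by (rule bounded_linear.has_vector_derivative[OF bounded_linear_wedge y])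
  have BBy: "((\<lambda>v. wedge f g (wedge f g (y v))) has_vector_derivative wedge f g (wedge f g y')) (at v)"
    by (rule bounded_linear.has_vector_derivative[OF bounded_linear_wedge By])
  have s: "((\<lambda>v. gsin ?k (a v)) has_real_derivative (1 + ?k * gver ?k (a v)) * a') (at v)"
    by (rule DERIV_chain2[OF has_real_derivative_gsin a])
  have c: "((\<lambda>v. gver ?k (a v)) has_real_derivative gsin ?k (a v) * a') (at v)"
    by (rule DERIV_chain2[OF has_real_derivative_gver a])
  show ?thesis
    unfolding rot_def Let_def
    by (rule has_vector_derivative_eq_rhs[OF has_vector_derivative_add[OF has_vector_derivative_add[OF y
        has_vector_derivative_scaleR[OF s By]] has_vector_derivative_scaleR[OF c BBy]]])
       (simp add: wedge_add wedge_scaleR wedge_cube[OF assms(1)] algebra_simps)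
qed

lemma constant_if_derivative_0:
  fixes h :: "real \<Rightarrow> 'b::real_normed_vector"
  assumes "is_interval J" "\<And>v. v \<in> J \<Longrightarrow> (h has_vector_derivative 0) (at v)" "a \<in> J" "b \<in> J"
  shows "h a = h b"
proof -
  obtain c where "\<And>v. v \<in> J \<Longrightarrow> h v = c"
    using has_vector_derivative_zero_constant[of J h] assms is_interval_convex
      has_vector_derivative_at_within by metis
  then show ?thesis using assms by simp
qed

lemma rot_plus:
  assumes "lorentz f g = 0"
  shows "rot f g (s + t) x = rot f g s (rot f g t x)"
proof -
  let ?h = "\<lambda>v. rot f g (- v) (rot f g (v + (s + t)) x)"
  have "(?h has_vector_derivative 0) (at v)" for v
    by (rule has_vector_derivative_eq_rhs[OF has_vector_derivative_rot[OF assms _ has_vector_derivative_rot[OF assms]]])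
       (auto intro!: derivative_eq_intros simp: rot_def Let_def wedge_add wedge_scaleR wedge_zero algebra_simps)
  then have "?h 0 = ?h (- s)" by (intro constant_if_derivative_0[of UNIV]) auto
  then show ?thesis by simp
qed

lemma lorentz_rot:
  assumes "lorentz f g = 0"
  shows "lorentz (rot f g t x) (rot f g t y) = lorentz x y"
proof -
  have W: "wedge f g (rot f g t x) = rot f g t (wedge f g x)" for t x
    by (simp add: rot_def Let_def wedge_add wedge_scaleR)
  let ?h = "\<lambda>t. lorentz (rot f g t x) (rot f g t y)"
  have R: "((\<lambda>t. rot f g t z) has_vector_derivative rot f g t (wedge f g z)) (at t)" for t z
    using has_vector_derivative_rot[OF assms DERIV_ident has_vector_derivative_const] by simp
  have "(?h has_vector_derivative 0) (at t)" for t
    by (rule has_vector_derivative_eq_rhs[OF lorentz.has_vector_derivative[OF R R]])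
       (simp add: W[symmetric] wedge_skew)
  then have "?h t = ?h 0" by (intro constant_if_derivative_0[of UNIV]) auto
  then show ?thesis by simp
qed

text \<open>The curve \<open>rot f g (v - w) (y w)\<close> in \<open>w\<close> is constant; compare its values at \<open>v\<close> and \<open>v0\<close>.\<close>

lemma rot_unique:
  assumes "lorentz f g = 0" "is_interval J" "v \<in> J" "v0 \<in> J"
    and "\<And>v. v \<in> J \<Longrightarrow> (y has_vector_derivative wedge f g (y v)) (at v)"
  shows "y v = rot f g (v - v0) (y v0)"
proof -
  let ?h = "\<lambda>w. rot f g (v - w) (y w)"
  have "(?h has_vector_derivative 0) (at w)" if "w \<in> J" for w
    by (rule has_vector_derivative_eq_rhs[OF has_vector_derivative_rot[OF assms(1) _ assms(5)[OF that], of _ "-1"]])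
       (auto intro!: derivative_eq_intros simp: rot_zero)
  then have "?h v = ?h v0" using assms by (intro constant_if_derivative_0[of J]) auto
  then show ?thesis by simp
qed

text \<open>The axis passes through \<open>x0\<close> in the direction orthogonal to \<open>f\<close> and \<open>g\<close>, on which the generator
vanishes.\<close>

lemma rotation_group_rot:
  assumes "lorentz f g = 0" and ne: "wedge f g z \<noteq> 0"
  shows "rotation_group (\<lambda>t x. x0 + rot f g t (x - x0))"
proof -
  define \<phi> where "\<phi> t x = x0 + rot f g t (x - x0)" for t x
  have add: "\<phi> (s + t) = \<phi> s \<circ> \<phi> t" for s t
    by (auto simp: \<phi>_def rot_plus[OF assms(1)] fun_eq_iff)
  have zero: "\<phi> 0 = id" by (auto simp: \<phi>_def)
  have \<phi>_affine: "\<phi> t = (\<lambda>x. (x0 - rot f g t x0) + rot f g t x)" for t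
    by (simp add: \<phi>_def rot_diff fun_eq_iff)
  have dphi: "(\<phi> t has_derivative rot f g t) (at p)" for t p
    unfolding \<phi>_affine by (auto intro!: derivative_eq_intros bounded_linear_imp_has_derivative bounded_linear_rot)
  have R: "((\<lambda>t. rot f g t y) has_vector_derivative rot f g t (wedge f g y)) (at t)" for t y
    using has_vector_derivative_rot[OF assms(1) DERIV_ident has_vector_derivative_const] by simp
  have isom: "lorentz_isometry (\<phi> t)" for t
    unfolding lorentz_isometry_def
  proof (intro conjI allI)
    have "\<phi> t \<circ> \<phi> (- t) = id" "\<phi> (- t) \<circ> \<phi> t = id"
      using add[of t "- t"] add[of "- t" t] zero by simp_all
    then show "bij (\<phi> t)" by (metis o_bij)
    show "smooth_on UNIV (\<phi> t)"
      unfolding \<phi>_affine smooth_on_def by (intro allI Ck_on_affine open_UNIV bounded_linear_rot)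
    show "lorentz (frechet_derivative (\<phi> t) (at p) w) (frechet_derivative (\<phi> t) (at p) z) = lorentz w z" for p w z
      by (simp add: frechet_derivative_at[OF dphi[of t p], symmetric] lorentz_rot[OF assms(1)])
  qed
  have smooth: "smooth_on UNIV (\<lambda>t. \<phi> t x)" for x
  proof -
    let ?F = "\<lambda>(c, y) t. c + rot f g t y"
    have "smooth_on UNIV (?F (x0, x - x0))"
    proof (rule smooth_on_curve_family[where d = "\<lambda>(c, y). (0, wedge f g y)"])
      show "(?F i has_vector_derivative ?F (case i of (c, y) \<Rightarrow> (0, wedge f g y)) s) (at s)" for i s
        by (cases i) (auto intro!: derivative_eq_intros R)
      show "\<exists>j. \<forall>s\<in>UNIV. r *\<^sub>R ?F i s = ?F j s" for i r
        by (rule exI[of _ "(r *\<^sub>R fst i, r *\<^sub>R snd i)"]) (auto simp: rot_scaleR algebra_simps split_beta)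
    qed simp
    then show ?thesis by (simp add: \<phi>_def)
  qed
  have nontriv: "\<exists>t. \<phi> t \<noteq> id"
  proof (rule ccontr)
    assume "\<nexists>t. \<phi> t \<noteq> id"
    then have "\<phi> t (x0 + z) = x0 + z" for t by simp
    then have const: "(\<lambda>t. rot f g t z) = (\<lambda>t. z)" by (simp add: \<phi>_def fun_eq_iff)
    have "((\<lambda>t. z) has_vector_derivative wedge f g z) (at 0)"
      using R[of z 0] unfolding const by simp
    then show False using ne vector_derivative_unique_at has_vector_derivative_const by metis
  qed
  obtain d where d: "d \<noteq> 0" "lorentz f d = 0" "lorentz g d = 0"
    using exists_orthogonal_to_pair by blast
  then have "\<phi> t (x0 + r *\<^sub>R d) = x0 + r *\<^sub>R d" for t r
    by (simp add: \<phi>_def rot_scaleR) (simp add: rot_def wedge_def Let_def lorentz_simps)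
  then show ?thesis
    unfolding rotation_group_def \<phi>_def[symmetric] using isom zero add smooth nontriv d(1) by blast
qed

section \<open>Planes as surfaces of revolution\<close>

text \<open>Within an open quadrant the orbits of the hyperbolic rotations are the level sets of the product
\<open>p q\<close>. Along the spiral this product is \<open>s\<^sup>2 cos s sin s\<close>, which on each passage of the spiral
from the axis to the diagonal takes all values between \<open>0\<close> and \<open>\<plusminus>s\<^sup>2 / 2\<close>.\<close>

lemma spiral_meets_open_quadrant:
  fixes p q :: real
  assumes "p > 0" "q \<noteq> 0"
  shows "\<exists>s t. p = exp t * (s * cos s) \<and> q = exp (- t) * (s * sin s)"
proof -
  define \<eta> :: real where "\<eta> = sgn q"
  have \<eta>: "\<eta> \<in> {-1, 1}" "q = \<eta> * \<bar>q\<bar>" "\<eta> * \<eta> = 1" using assms by (auto simp: \<eta>_def sgn_if)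
  obtain m :: nat where m: "p * \<bar>q\<bar> < real m" using reals_Archimedean2 by blast
  \<comment> \<open>The turn number is chosen so large that \<open>s\<^sup>2 / 2\<close> exceeds \<open>p * \<bar>q\<bar>\<close> on the diagonal.\<close>
  define n where "n = Suc m"
  define a where "a = 2 * real n * pi"
  have n: "real n \<ge> 1" "p * \<bar>q\<bar> \<le> real n" using m by (auto simp: n_def)
  have "pi * real n \<ge> 3 * real n" using pi_gt3 by (intro mult_right_mono) auto
  moreover have "pi \<le> pi * real n" using n(1) by simp
  moreover have "a = 2 * (pi * real n)" by (simp add: a_def)
  ultimately have a: "a - pi / 4 \<ge> 2 * real n" "a > 0"
    using pi_gt3 n(1) by linarith+
  let ?h = "\<lambda>x. (a + \<eta> * x)\<^sup>2 * (cos x * sin x)"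
  have "(2 * real n)\<^sup>2 \<le> (a + \<eta> * (pi / 4))\<^sup>2" using a \<eta>(1) pi_gt3 n by (intro power_mono) auto
  then have "4 * (real n)\<^sup>2 \<le> (a + \<eta> * (pi / 4))\<^sup>2" by (simp add: power_mult_distrib)
  then have "(real n)\<^sup>2 \<le> (a + \<eta> * (pi / 4))\<^sup>2 / 2"
    using zero_le_power2[of "real n"] by linarith
  also have "\<dots> = ?h (pi / 4)" by (simp add: cos_45 sin_45 power2_eq_square)
  finally have "(real n)\<^sup>2 \<le> ?h (pi / 4)" .
  moreover have "real n \<le> (real n)\<^sup>2" using n by (simp add: power2_eq_square)
  ultimately have "p * \<bar>q\<bar> \<le> ?h (pi / 4)" using n by linarith
  moreover have "?h 0 \<le> p * \<bar>q\<bar>" using assms by simp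
  moreover have "continuous_on {0..pi / 4} ?h" by (intro continuous_intros)
  ultimately obtain x where x: "0 \<le> x" "x \<le> pi / 4" "?h x = p * \<bar>q\<bar>"
    using IVT'[of ?h 0 "p * \<bar>q\<bar>" "pi / 4"] by auto
  have "x \<noteq> 0" using x(3) assms by auto
  then have pos: "cos x > 0" "sin x > 0"
    using x pi_gt_zero by (auto intro!: cos_gt_zero_pi sin_gt_zero)
  define s where "s = a + \<eta> * x"
  have s: "s > 0" using a x \<eta>(1) n by (auto simp: s_def)
  have per: "cos (a + y) = cos y" "sin (a + y) = sin y" for y
    unfolding a_def cos_add sin_add cos_2npi sin_2npi by simp_all
  have cs: "cos s = cos x" "sin s = \<eta> * sin x" using \<eta>(1) by (auto simp: s_def per)
  define t where "t = ln (p / (s * cos s))"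
  have et: "exp t = p / (s * cos s)" using assms s pos cs by (simp add: t_def)
  then have "p = exp t * (s * cos s)" using s pos cs by simp
  moreover have "exp (- t) * (s * sin s) = (s * cos s / p) * (s * sin s)"
    using et by (simp add: exp_minus)
  then have "exp (- t) * (s * sin s) = \<eta> * (s\<^sup>2 * (cos x * sin x)) / p"
    by (simp add: cs power2_eq_square)
  then have "exp (- t) * (s * sin s) = q" using x(3) \<eta>(2) assms by (simp add: s_def)
  ultimately show ?thesis by metis
qed

text \<open>The plane splits into many kinds of orbits of hyperbolic rotations: hyperbola branches in four
quadrants, four null half-lines, and the centre. A straight line misses some of them; the spiral
meets all of them.\<close>

lemma spiral_meets_boost_orbits:
  fixes p q :: real
  shows "\<exists>s t. p = exp t * (s * cos s) \<and> q = exp (- t) * (s * sin s)"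
proof -
  have reflect: "\<exists>s t. p = exp t * (s * cos s) \<and> q = exp (- t) * (s * sin s)"
    if ex: "\<exists>s t. - p = exp t * (s * cos s) \<and> q = exp (- t) * (s * sin s)" for p q :: real
  proof -
    obtain s t where "- p = exp t * (s * cos s)" "q = exp (- t) * (s * sin s)" using ex by blast
    then show ?thesis by (intro exI[of _ "- s"] exI[of _ t]) auto
  qed
  have half: "\<exists>s t. p = exp t * (s * cos s) \<and> q = exp (- t) * (s * sin s)" if p: "p > 0" for p q :: real
  proof (cases "q = 0")
    case True
    show ?thesis
      using p True by (intro exI[of _ "2 * pi"] exI[of _ "ln (p / (2 * pi))"]) auto
  qed (use spiral_meets_open_quadrant p in blast)
  have scale: "exp (ln (x / r)) * r = x" if "x > 0" "r > 0" for x r :: real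
    using that by simp
  consider "p > 0" | "p < 0" | "p = 0" "q > 0" | "p = 0" "q < 0" | "p = 0" "q = 0" by linarith
  then show ?thesis
  proof cases
    case 1
    then show ?thesis by (rule half)
  next
    case 2
    then show ?thesis by (intro reflect[OF half]) simp
  next
    case 3
    have "q = exp (- (- ln (q / (pi / 2)))) * (pi / 2 * sin (pi / 2))"
      using scale[of q "pi / 2"] 3 by simp
    moreover have "p = exp t * (pi / 2 * cos (pi / 2))" for t using 3 by simp
    ultimately show ?thesis by blast
  next
    case 4
    define r where "r = 3 / 2 * pi"
    have r: "cos r = 0" "sin r = - 1" "r > 0"
      using cos_3over2_pi sin_3over2_pi by (auto simp: r_def)
    have "q = exp (- (- ln (- q / r))) * (r * sin r)"
      using scale[of "- q" r] 4 r by simp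
    moreover have "p = exp t * (r * cos r)" for t using 4 r by simp
    ultimately show ?thesis by blast
  next
    case 5
    then show ?thesis by (intro exI[of _ 0]) auto
  qed
qed

lemma smooth_spiral:
  fixes A B a :: "'b::euclidean_space"
  shows "smooth_on UNIV (\<lambda>s::real. a + ((s * cos s) *\<^sub>R A + (s * sin s) *\<^sub>R B))"
proof -
  let ?F = "\<lambda>(a :: 'b, A :: 'b, B :: 'b, C :: 'b, D :: 'b) s. a + ((s * cos s) *\<^sub>R A + (s * sin s) *\<^sub>R B + cos s *\<^sub>R C + sin s *\<^sub>R D)"
  have "smooth_on UNIV (?F (a, A, B, 0, 0))"
  proof (rule smooth_on_curve_family[where d = "\<lambda>(a, A, B, C, D). (0, B, - A, A + D, B - C)"])
    show "(?F i has_vector_derivative ?F (case i of (a, A, B, C, D) \<Rightarrow> (0, B, - A, A + D, B - C)) s) (at s)" for i s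
      by (cases i) (auto intro!: derivative_eq_intros simp: algebra_simps)
    show "\<exists>j. \<forall>s\<in>UNIV. r *\<^sub>R ?F i s = ?F j s" for i r
    proof (cases i)
      case (fields a A B C D)
      then show ?thesis
        by (intro exI[of _ "(r *\<^sub>R a, r *\<^sub>R A, r *\<^sub>R B, r *\<^sub>R C, r *\<^sub>R D)"])
           (simp add: scaleR_add_right mult.commute mult.left_commute)
    qed
  qed simp
  then show ?thesis by simp
qed

text \<open>A spacelike plane is swept out by rotating a line about a point of it. A timelike plane is swept
out by the hyperbolic rotations of a spiral in null coordinates \<open>P\<close>, \<open>Q\<close>, in which the group acts
by reciprocal scalings.\<close>

lemma plane_swept_by_rotations:
  assumes \<delta>: "\<delta> \<in> {-1, 1}" and \<epsilon>: "\<epsilon> \<in> {-1, 1}" and signs: "\<not> (\<delta> = -1 \<and> \<epsilon> = -1)"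
    and F: "lorentz F F = \<delta>" and G: "lorentz G G = \<epsilon>" and FG: "lorentz F G = 0"
  obtains \<phi> \<gamma> where "rotation_group \<phi>" "smooth_on UNIV \<gamma>"
    "\<And>s. vector_derivative \<gamma> (at s) \<noteq> 0" "\<And>p q. \<exists>t s. a + p *\<^sub>R F + q *\<^sub>R G = \<phi> t (\<gamma> s)"
proof -
  have GF: "lorentz G F = 0" using FG lorentz_commute by metis
  have W: "wedge F G F = \<delta> *\<^sub>R G" "wedge F G G = - \<epsilon> *\<^sub>R F"
    using F G FG GF by (auto simp: wedge_def)
  have ne: "F \<noteq> 0" "G \<noteq> 0" using F G \<delta> \<epsilon> by (auto simp: lorentz.zero_left)
  let ?\<phi> = "\<lambda>t x. a + rot F G t (x - a)"
  have rg: "rotation_group ?\<phi>"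
    by (rule rotation_group_rot[OF FG, where z = F]) (use W ne \<delta> in auto)
  show ?thesis
  proof (cases "\<delta> = \<epsilon>")
    case True
    then have 1: "\<delta> = 1" "\<epsilon> = 1" using \<delta> signs by auto
    have rotF: "rot F G t F = cos t *\<^sub>R F + sin t *\<^sub>R G" for t
      using gsin_gver_neg[of 1] F G
      by (simp add: rot_def Let_def W 1 wedge_scaleR wedge_def[of F G "- F"] algebra_simps)
    show ?thesis
    proof (rule that[OF rg, of "\<lambda>s. a + s *\<^sub>R F"])
      show "smooth_on UNIV (\<lambda>s. a + s *\<^sub>R F)"
        unfolding smooth_on_def by (intro allI Ck_on_affine bounded_linear_scaleR_left) simp
      show "vector_derivative (\<lambda>s. a + s *\<^sub>R F) (at s) \<noteq> 0" for s
      proof -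
        have "((\<lambda>s. a + s *\<^sub>R F) has_vector_derivative F) (at s)"
          by (auto intro!: derivative_eq_intros)
        then show ?thesis using ne vector_derivative_at by metis
      qed
      show "\<exists>t s. a + p *\<^sub>R F + q *\<^sub>R G = a + rot F G t (a + s *\<^sub>R F - a)" for p q
      proof -
        obtain r t where "p = r * cos t" "q = r * sin t" using polar_Ex by metis
        then show ?thesis
          by (intro exI[of _ t] exI[of _ r]) (simp add: rot_scaleR rotF algebra_simps)
      qed
    qed
  next
    case False
    then have \<epsilon>\<delta>: "\<epsilon> = - \<delta>" and \<delta>\<delta>: "\<delta> * \<delta> = 1" using \<delta> \<epsilon> by auto
    define P where "P = F + G"
    define Q where "Q = F - G"
    have WP: "wedge F G P = \<delta> *\<^sub>R P" and WQ: "wedge F G Q = - \<delta> *\<^sub>R Q"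
      by (simp_all add: P_def Q_def wedge_add wedge_diff W \<epsilon>\<delta> algebra_simps)
    have k: "- (lorentz F F * lorentz G G) = 1" using F G \<epsilon>\<delta> \<delta>\<delta> by simp
    have hyp: "gsin 1 t = sinh t" "gver 1 t = cosh t - 1" for t
      using gsin_gver_pos[of 1] by simp_all
    have rotP: "rot F G t P = exp (\<delta> * t) *\<^sub>R P" and rotQ: "rot F G t Q = exp (- (\<delta> * t)) *\<^sub>R Q" for t
    proof -
      have "1 + sinh t * \<delta> + (cosh t - 1) = exp (\<delta> * t)"
        "1 - sinh t * \<delta> + (cosh t - 1) = exp (- (\<delta> * t))"
        using \<delta> cosh_plus_sinh[of t] cosh_minus_sinh[of t] by auto
      moreover have "rot F G t P = (1 + sinh t * \<delta> + (cosh t - 1)) *\<^sub>R P"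
        "rot F G t Q = (1 - sinh t * \<delta> + (cosh t - 1)) *\<^sub>R Q"
        unfolding rot_def Let_def k hyp
        by (simp_all add: WP WQ wedge_scaleR wedge_minus \<delta>\<delta> algebra_simps)
      ultimately show "rot F G t P = exp (\<delta> * t) *\<^sub>R P" "rot F G t Q = exp (- (\<delta> * t)) *\<^sub>R Q"
        by simp_all
    qed
    have PQ: "lorentz P P = 0" "lorentz Q Q = 0" "lorentz P Q = 2 * \<delta>" "lorentz Q P = 2 * \<delta>"
      using F G FG GF \<epsilon>\<delta> by (auto simp: P_def Q_def lorentz_simps)
    let ?\<gamma> = "\<lambda>s. a + ((s * cos s) *\<^sub>R P + (s * sin s) *\<^sub>R Q)"
    show ?thesis
    proof (rule that[OF rg, of ?\<gamma>])
      show "smooth_on UNIV ?\<gamma>" by (rule smooth_spiral)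
      show "vector_derivative ?\<gamma> (at s) \<noteq> 0" for s
      proof -
        \<comment> \<open>The velocity vanishes nowhere since its squared coordinates add up to \<open>1 + s\<^sup>2\<close>.\<close>
        let ?x = "cos s - s * sin s" and ?y = "sin s + s * cos s"
        have "(?\<gamma> has_vector_derivative ?x *\<^sub>R P + ?y *\<^sub>R Q) (at s)"
          by (auto intro!: derivative_eq_intros simp: algebra_simps)
        then have D: "vector_derivative ?\<gamma> (at s) = ?x *\<^sub>R P + ?y *\<^sub>R Q" by (rule vector_derivative_at)
        have "?x\<^sup>2 + ?y\<^sup>2 = (1 + s\<^sup>2) * ((sin s)\<^sup>2 + (cos s)\<^sup>2)" by algebra
        then have "?x\<^sup>2 + ?y\<^sup>2 > 0" by (simp add: add_pos_nonneg)
        moreover have "lorentz (?x *\<^sub>R P + ?y *\<^sub>R Q) Q = 2 * \<delta> * ?x" "lorentz (?x *\<^sub>R P + ?y *\<^sub>R Q) P = 2 * \<delta> * ?y"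
          using PQ by (simp_all add: lorentz_simps)
        moreover have "?x = 0 \<and> ?y = 0" if "?x *\<^sub>R P + ?y *\<^sub>R Q = 0"
          using calculation(2,3) \<delta> unfolding that lorentz.zero_left by auto
        ultimately show ?thesis unfolding D by fastforce
      qed
      show "\<exists>t s. a + p *\<^sub>R F + q *\<^sub>R G = a + rot F G t (?\<gamma> s - a)" for p q
      proof -
        obtain s t where st: "(p + q) / 2 = exp t * (s * cos s)" "(p - q) / 2 = exp (- t) * (s * sin s)"
          using spiral_meets_boost_orbits by blast
        have "p *\<^sub>R F + q *\<^sub>R G = ((p + q) / 2) *\<^sub>R P + ((p - q) / 2) *\<^sub>R Q"
        proof -
          have "x *\<^sub>R P + y *\<^sub>R Q = (x + y) *\<^sub>R F + (x - y) *\<^sub>R G" for x y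
            by (simp add: P_def Q_def algebra_simps)
          moreover have "(p + q) / 2 + (p - q) / 2 = p" "(p + q) / 2 - (p - q) / 2 = q"
            by (simp_all add: field_simps)
          ultimately show ?thesis by simp
        qed
        also have "\<dots> = rot F G (\<delta> * t) (?\<gamma> s - a)"
        proof -
          have "\<delta> * (\<delta> * t) = t" using \<delta>\<delta> by (metis mult.assoc mult_1)
          then have "rot F G (\<delta> * t) P = exp t *\<^sub>R P" "rot F G (\<delta> * t) Q = exp (- t) *\<^sub>R Q"
            using rotP[of "\<delta> * t"] rotQ[of "\<delta> * t"] by simp_all
          then show ?thesis unfolding st by (simp add: rot_add rot_scaleR mult.commute)
        qed
        finally show ?thesis by (intro exI[of _ "\<delta> * t"] exI[of _ s]) (simp add: add.assoc)
      qed
    qed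
  qed
qed

section \<open>Isothermal coordinates\<close>

lemma lorentz_partial_u:
  assumes "open I" "smooth_on (I \<times> J) A" "smooth_on (I \<times> J) B"
    and "\<And>x. x \<in> I \<Longrightarrow> lorentz (A (x, v)) (B (x, v)) = h x"
    and "(h has_real_derivative h') (at u)" "u \<in> I" "v \<in> J"
  shows "lorentz (A (u, v)) (partial_u B (u, v)) + lorentz (partial_u A (u, v)) (B (u, v)) = h'"
proof -
  have "((\<lambda>x. lorentz (A (x, v)) (B (x, v))) has_vector_derivative
      lorentz (A (u, v)) (partial_u B (u, v)) + lorentz (partial_u A (u, v)) (B (u, v))) (at u)"
    by (rule lorentz.has_vector_derivative; rule smooth_on_partials) (use assms in auto)
  moreover have "((\<lambda>x. lorentz (A (x, v)) (B (x, v))) has_vector_derivative h') (at u)"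
    by (rule has_vector_derivative_transform_within_open[OF _ \<open>open I\<close> \<open>u \<in> I\<close>])
       (use assms in \<open>auto simp: has_real_derivative_iff_has_vector_derivative\<close>)
  ultimately show ?thesis by (rule vector_derivative_unique_at)
qed

lemma lorentz_partial_v:
  assumes "open J" "smooth_on (I \<times> J) A" "smooth_on (I \<times> J) B"
    and "\<And>y. y \<in> J \<Longrightarrow> lorentz (A (u, y)) (B (u, y)) = h"
    and "u \<in> I" "v \<in> J"
  shows "lorentz (A (u, v)) (partial_v B (u, v)) + lorentz (partial_v A (u, v)) (B (u, v)) = 0"
proof -
  have "((\<lambda>y. lorentz (A (u, y)) (B (u, y))) has_vector_derivative
      lorentz (A (u, v)) (partial_v B (u, v)) + lorentz (partial_v A (u, v)) (B (u, v))) (at v)"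
    by (rule lorentz.has_vector_derivative; rule smooth_on_partials) (use assms in auto)
  moreover have "((\<lambda>y. lorentz (A (u, y)) (B (u, y))) has_vector_derivative 0) (at v)"
    by (rule has_vector_derivative_transform_within_open[of "\<lambda>y. h", OF _ \<open>open J\<close> \<open>v \<in> J\<close>])
       (use assms in auto)
  ultimately show ?thesis by (rule vector_derivative_unique_at)
qed

text \<open>Intrinsic rotational coordinates with their signs and conformal factor fixed. The causal type is
not assumed, since the signs determine it.\<close>

locale isothermal_surface =
  fixes I J :: "real set" and X :: "real \<times> real \<Rightarrow> real ^ 3" and \<delta> \<epsilon> :: real and \<rho> :: "real \<Rightarrow> real"
  assumes I: "open_interval I" and J: "open_interval J" and smooth: "smooth_on (I \<times> J) X"
    and \<delta>: "\<delta> \<in> {-1, 1}" and \<epsilon>: "\<epsilon> \<in> {-1, 1}" and signs: "\<not> (\<delta> = -1 \<and> \<epsilon> = -1)"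
    and smooth_\<rho>: "smooth_on I \<rho>" and \<rho>_pos: "u \<in> I \<Longrightarrow> \<rho> u > 0"
    and metric: "u \<in> I \<Longrightarrow> v \<in> J \<Longrightarrow> lorentz (partial_u X (u, v)) (partial_u X (u, v)) = (\<rho> u)\<^sup>2 * \<delta>"
      "u \<in> I \<Longrightarrow> v \<in> J \<Longrightarrow> lorentz (partial_u X (u, v)) (partial_v X (u, v)) = 0"
      "u \<in> I \<Longrightarrow> v \<in> J \<Longrightarrow> lorentz (partial_v X (u, v)) (partial_v X (u, v)) = (\<rho> u)\<^sup>2 * \<epsilon>"
begin

lemma open_I: "open I" and open_J: "open J" and interval_I: "is_interval I" and interval_J: "is_interval J"
  using I J by (auto simp: open_interval_def)

lemma open_domain: "open (I \<times> J)" and convex_domain: "convex (I \<times> J)"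
  using open_I open_J interval_I interval_J
  by (auto simp: open_Times is_interval_convex convex_Times)

lemma sign_squares [simp]: "\<delta> * \<delta> = 1" "\<epsilon> * \<epsilon> = 1" "\<delta> * (\<delta> * x) = x" "\<epsilon> * (\<epsilon> * x) = x"
  using \<delta> \<epsilon> by auto

lemma smooth_partials: "smooth_on (I \<times> J) (partial_u X)" "smooth_on (I \<times> J) (partial_v X)"
  using smooth smooth_on_frechet_derivative by blast+

lemma \<rho>_derivative:
  assumes "u \<in> I"
  shows "\<exists>\<rho>'. (\<rho> has_real_derivative \<rho>') (at u)"
proof -
  have "\<rho> differentiable (at u)"
    using smooth_on_has_derivative[OF smooth_\<rho> assms] by (auto simp: differentiable_def)
  then show ?thesis by (simp add: real_differentiable_def)
qed

lemma metric': "u \<in> I \<Longrightarrow> v \<in> J \<Longrightarrow> lorentz (partial_v X (u, v)) (partial_u X (u, v)) = 0"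
  using metric(2) lorentz_commute by metis

lemma partials_independent:
  assumes "u \<in> I" "v \<in> J"
    and "a *\<^sub>R partial_u X (u, v) + b *\<^sub>R partial_v X (u, v) = c *\<^sub>R partial_u X (u, v) + d *\<^sub>R partial_v X (u, v)"
  shows "a = c" "b = d"
proof -
  have "lorentz (a *\<^sub>R partial_u X (u, v) + b *\<^sub>R partial_v X (u, v)) z =
      lorentz (c *\<^sub>R partial_u X (u, v) + d *\<^sub>R partial_v X (u, v)) z" for z
    using assms(3) by simp
  from this[of "partial_u X (u, v)"] this[of "partial_v X (u, v)"]
  show "a = c" "b = d"
    using metric[OF assms(1,2)] metric'[OF assms(1,2)] \<rho>_pos[OF assms(1)] \<delta> \<epsilon>
    by (auto simp: lorentz_simps)
qed

lemma mixed_partials: "u \<in> I \<Longrightarrow> v \<in> J \<Longrightarrow> partial_v (partial_u X) (u, v) = partial_u (partial_v X) (u, v)"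
  using mixed_partials_eq[OF open_I interval_I open_J interval_J smooth] .

text \<open>The Christoffel symbols of the first kind of the metric \<open>\<rho>(u)\<^sup>2 (\<delta> du\<^sup>2 + \<epsilon> dv\<^sup>2)\<close>.\<close>

lemma tangential_second_derivatives:
  assumes u: "u \<in> I" and v: "v \<in> J" and \<rho>': "(\<rho> has_real_derivative \<rho>') (at u)"
  defines "Xu \<equiv> partial_u X (u, v)" and "Xv \<equiv> partial_v X (u, v)"
    and "Xuu \<equiv> partial_u (partial_u X) (u, v)" and "Xuv \<equiv> partial_v (partial_u X) (u, v)"
    and "Xvv \<equiv> partial_v (partial_v X) (u, v)"
  shows "lorentz Xuu Xu = \<delta> * \<rho> u * \<rho>'" "lorentz Xuu Xv = 0"
    "lorentz Xuv Xu = 0" "lorentz Xuv Xv = \<epsilon> * \<rho> u * \<rho>'"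
    "lorentz Xvv Xu = - (\<epsilon> * \<rho> u * \<rho>')" "lorentz Xvv Xv = 0"
proof -
  note sm = smooth_partials
  have d: "((\<lambda>u. (\<rho> u)\<^sup>2 * k) has_real_derivative 2 * k * \<rho> u * \<rho>') (at u)" for k
    by (auto intro!: derivative_eq_intros \<rho>')
  have "lorentz Xu Xuu + lorentz Xuu Xu = 2 * \<delta> * \<rho> u * \<rho>'"
    unfolding Xu_def Xuu_def by (rule lorentz_partial_u[OF open_I sm(1,1) _ d u v]) (use metric v in auto)
  then show "lorentz Xuu Xu = \<delta> * \<rho> u * \<rho>'" by (simp add: lorentz_commute)
  have "lorentz Xu Xuv + lorentz Xuv Xu = 0"
    unfolding Xu_def Xuv_def by (rule lorentz_partial_v[OF open_J sm(1,1) _ u v]) (use metric u in auto)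
  then show 1: "lorentz Xuv Xu = 0" by (simp add: lorentz_commute)
  have "lorentz Xv Xuv + lorentz Xuv Xv = 2 * \<epsilon> * \<rho> u * \<rho>'"
    unfolding Xv_def Xuv_def mixed_partials[OF u v]
    by (rule lorentz_partial_u[OF open_I sm(2,2) _ d u v]) (use metric v in auto)
  then show 2: "lorentz Xuv Xv = \<epsilon> * \<rho> u * \<rho>'" by (simp add: lorentz_commute)
  have "lorentz Xu Xuv + lorentz Xuu Xv = 0"
    unfolding Xu_def Xv_def Xuu_def Xuv_def mixed_partials[OF u v]
    by (rule lorentz_partial_u[OF open_I sm(1,2) _ DERIV_const u v]) (use metric v in auto)
  then show "lorentz Xuu Xv = 0" using 1 by (simp add: lorentz_commute)
  have "lorentz Xu Xvv + lorentz Xuv Xv = 0"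
    unfolding Xu_def Xv_def Xvv_def Xuv_def
    by (rule lorentz_partial_v[OF open_J sm(1,2) _ u v]) (use metric u in auto)
  then show "lorentz Xvv Xu = - (\<epsilon> * \<rho> u * \<rho>')" using 2 by (simp add: lorentz_commute)
  have "lorentz Xv Xvv + lorentz Xvv Xv = 0"
    unfolding Xv_def Xvv_def by (rule lorentz_partial_v[OF open_J sm(2,2) _ u v]) (use metric u in auto)
  then show "lorentz Xvv Xv = 0" by (simp add: lorentz_commute)
qed

lemma fundform1_eq:
  assumes "u \<in> I" "v \<in> J"
  shows "fundform1 X (u, v) w w = (\<rho> u)\<^sup>2 * (\<delta> * (fst w)\<^sup>2 + \<epsilon> * (snd w)\<^sup>2)"
  using metric[OF assms] metric'[OF assms] smooth_on_has_derivative[OF smooth, of "(u, v)"] assms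
  unfolding fundform1_def
  by (subst (1 2) derivative_by_partials[of _ w])
     (auto simp: has_derivative_linear lorentz_simps power2_eq_square algebra_simps)

lemma spacelike_at_iff:
  assumes "u \<in> I" "v \<in> J"
  shows "spacelike_at X (u, v) \<longleftrightarrow> \<delta> * \<epsilon> = 1"
proof
  assume "spacelike_at X (u, v)"
  then have "fundform1 X (u, v) w w > 0" if "w \<noteq> 0" for w using that unfolding spacelike_at_def by blast
  from this[of "(1, 0)"] this[of "(0, 1)"] show "\<delta> * \<epsilon> = 1"
    using \<delta> \<epsilon> \<rho>_pos[OF assms(1)] by (auto simp: fundform1_eq[OF assms] zero_prod_def)
next
  assume "\<delta> * \<epsilon> = 1"
  then have "\<delta> = 1" "\<epsilon> = 1" using \<delta> \<epsilon> signs by auto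
  then show "spacelike_at X (u, v)"
    using \<rho>_pos[OF assms(1)] sum_power2_gt_zero_iff
    by (auto simp: spacelike_at_def fundform1_eq[OF assms] zero_prod_def intro!: mult_pos_pos)
qed

lemma timelike_at_iff:
  assumes "u \<in> I" "v \<in> J"
  shows "timelike_at X (u, v) \<longleftrightarrow> \<delta> * \<epsilon> = -1"
proof
  assume "timelike_at X (u, v)"
  then obtain w where "fundform1 X (u, v) w w < 0" by (auto simp: timelike_at_def)
  then have neg: "(\<rho> u)\<^sup>2 * (\<delta> * (fst w)\<^sup>2 + \<epsilon> * (snd w)\<^sup>2) < 0"
    by (simp only: fundform1_eq[OF assms])
  have "\<not> (\<delta> = 1 \<and> \<epsilon> = 1)"
  proof
    assume "\<delta> = 1 \<and> \<epsilon> = 1"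
    with neg have "(\<rho> u)\<^sup>2 * ((fst w)\<^sup>2 + (snd w)\<^sup>2) < 0" by simp
    moreover have "0 \<le> (\<rho> u)\<^sup>2 * ((fst w)\<^sup>2 + (snd w)\<^sup>2)" by (intro mult_nonneg_nonneg) auto
    ultimately show False by linarith
  qed
  then show "\<delta> * \<epsilon> = -1" using \<delta> \<epsilon> signs by auto
next
  assume "\<delta> * \<epsilon> = -1"
  then have "\<delta> = 1 \<and> \<epsilon> = -1 \<or> \<delta> = -1 \<and> \<epsilon> = 1" using \<delta> \<epsilon> by auto
  moreover have "fundform1 X (u, v) (1, 0) (1, 0) = (\<rho> u)\<^sup>2 * \<delta>" "fundform1 X (u, v) (0, 1) (0, 1) = (\<rho> u)\<^sup>2 * \<epsilon>"
    by (simp_all add: fundform1_eq[OF assms])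
  moreover have "(\<rho> u)\<^sup>2 > 0" using \<rho>_pos[OF assms(1)] by simp
  ultimately have "fundform1 X (u, v) (1, 0) (1, 0) > 0 \<and> fundform1 X (u, v) (0, 1) (0, 1) < 0 \<or>
      fundform1 X (u, v) (0, 1) (0, 1) > 0 \<and> fundform1 X (u, v) (1, 0) (1, 0) < 0"
    by auto
  then show "timelike_at X (u, v)" unfolding timelike_at_def by blast
qed

lemma nonempty: "I \<noteq> {}" "J \<noteq> {}"
  using I J by (auto simp: open_interval_def)

lemma spacelike_surface_iff: "spacelike_surface (I \<times> J) X \<longleftrightarrow> \<delta> * \<epsilon> = 1"
  using spacelike_at_iff open_domain smooth nonempty by (auto simp: spacelike_surface_def)

lemma timelike_surface_iff: "timelike_surface (I \<times> J) X \<longleftrightarrow> \<delta> * \<epsilon> = -1"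
  using timelike_at_iff open_domain smooth nonempty by (auto simp: timelike_surface_def)

lemma nondegenerate: "nondegenerate_surface (I \<times> J) X"
  using \<delta> \<epsilon> by (auto simp: nondegenerate_surface_def spacelike_surface_iff timelike_surface_iff)

lemma causal_sign_eq: "u \<in> I \<Longrightarrow> v \<in> J \<Longrightarrow> causal_sign X (u, v) = \<delta> * \<epsilon>"
  using \<delta> \<epsilon> by (auto simp: causal_sign_def spacelike_at_iff)

end

locale isothermal_surface_normal = isothermal_surface +
  fixes N :: "real \<times> real \<Rightarrow> real ^ 3"
  assumes unit_normal: "unit_normal_field (I \<times> J) X N"
begin

lemma smooth_N: "smooth_on (I \<times> J) N"
  using unit_normal by (simp add: unit_normal_field_def)

lemma normal:
  assumes "u \<in> I" "v \<in> J"
  shows "lorentz (N (u, v)) (partial_u X (u, v)) = 0" "lorentz (N (u, v)) (partial_v X (u, v)) = 0"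
    "lorentz (N (u, v)) (N (u, v)) = - (\<delta> * \<epsilon>)"
  using unit_normal assms causal_sign_eq[OF assms] by (auto simp: unit_normal_field_def)

lemma frame_eqI:
  assumes "u \<in> I" "v \<in> J"
    and "lorentz x (partial_u X (u, v)) = lorentz y (partial_u X (u, v))"
    and "lorentz x (partial_v X (u, v)) = lorentz y (partial_v X (u, v))"
    and "lorentz x (N (u, v)) = lorentz y (N (u, v))"
  shows "x = y"
  by (rule orthogonal_frame_eqI[OF _ _ _ _ _ _ assms(3-5)])
     (use metric[OF assms(1,2)] normal[OF assms(1,2)] \<rho>_pos[OF assms(1)] \<delta> \<epsilon> in auto)

lemma second_fundamental_form:
  assumes u: "u \<in> I" and v: "v \<in> J"
  shows "lorentz (partial_u N (u, v)) (partial_u X (u, v)) = - lorentz (partial_u (partial_u X) (u, v)) (N (u, v))"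
    and "lorentz (partial_v N (u, v)) (partial_v X (u, v)) = - lorentz (partial_v (partial_v X) (u, v)) (N (u, v))"
    and "lorentz (partial_u N (u, v)) (partial_v X (u, v)) = - lorentz (partial_v (partial_u X) (u, v)) (N (u, v))"
    and "lorentz (partial_v N (u, v)) (partial_u X (u, v)) = - lorentz (partial_v (partial_u X) (u, v)) (N (u, v))"
  using lorentz_partial_u[OF open_I smooth_N smooth_partials(1) normal(1)[OF _ v] DERIV_const u v]
    lorentz_partial_v[OF open_J smooth_N smooth_partials(2) normal(2)[OF u] u v]
    lorentz_partial_u[OF open_I smooth_N smooth_partials(2) normal(2)[OF _ v] DERIV_const u v]
    lorentz_partial_v[OF open_J smooth_N smooth_partials(1) normal(1)[OF u] u v]
    mixed_partials[OF u v]
  by (simp_all add: lorentz_commute)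

lemma derivative_of_normal_tangential:
  assumes u: "u \<in> I" and v: "v \<in> J"
  shows "lorentz (partial_u N (u, v)) (N (u, v)) = 0" "lorentz (partial_v N (u, v)) (N (u, v)) = 0"
  using lorentz_partial_u[OF open_I smooth_N smooth_N normal(3)[OF _ v] DERIV_const u v]
    lorentz_partial_v[OF open_J smooth_N smooth_N normal(3)[OF u] u v]
  by (simp_all add: lorentz_commute)

lemma weingarten_eq:
  assumes u: "u \<in> I" and v: "v \<in> J"
  shows "weingarten N (u, v) (1, 0) = - partial_u N (u, v)" "weingarten N (u, v) (0, 1) = - partial_v N (u, v)"
  using derivative_of_normal_tangential[OF assms] by (simp_all add: weingarten_def tangential_part_def)

lemma weingarten_matrix_unique:
  assumes u: "u \<in> I" and v: "v \<in> J"
    and "- partial_u N (u, v) = M $ 1 $ 1 *\<^sub>R partial_u X (u, v) + M $ 2 $ 1 *\<^sub>R partial_v X (u, v)"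
    and "- partial_v N (u, v) = M $ 1 $ 2 *\<^sub>R partial_u X (u, v) + M $ 2 $ 2 *\<^sub>R partial_v X (u, v)"
  shows "weingarten_matrix X N (u, v) = M"
  unfolding weingarten_matrix_def weingarten_eq[OF u v] assms(3,4)
proof (rule the_equality)
  fix M' :: "real ^ 2 ^ 2"
  assume M': "M $ 1 $ 1 *\<^sub>R partial_u X (u, v) + M $ 2 $ 1 *\<^sub>R partial_v X (u, v) =
      M' $ 1 $ 1 *\<^sub>R partial_u X (u, v) + M' $ 2 $ 1 *\<^sub>R partial_v X (u, v) \<and>
      M $ 1 $ 2 *\<^sub>R partial_u X (u, v) + M $ 2 $ 2 *\<^sub>R partial_v X (u, v) =
      M' $ 1 $ 2 *\<^sub>R partial_u X (u, v) + M' $ 2 $ 2 *\<^sub>R partial_v X (u, v)"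
  then show "M' = M"
    using partials_independent[OF u v conjunct1[OF M']] partials_independent[OF u v conjunct2[OF M']]
    by (simp add: vec_eq_iff forall_2)
qed simp

lemma weingarten_matrix_works:
  assumes u: "u \<in> I" and v: "v \<in> J"
  defines "M \<equiv> weingarten_matrix X N (u, v)"
  shows "- partial_u N (u, v) = M $ 1 $ 1 *\<^sub>R partial_u X (u, v) + M $ 2 $ 1 *\<^sub>R partial_v X (u, v)"
    and "- partial_v N (u, v) = M $ 1 $ 2 *\<^sub>R partial_u X (u, v) + M $ 2 $ 2 *\<^sub>R partial_v X (u, v)"
proof -
  let ?Xu = "partial_u X (u, v)" and ?Xv = "partial_v X (u, v)"
  define a b where "a z = \<delta> * lorentz z ?Xu / (\<rho> u)\<^sup>2" and "b z = \<epsilon> * lorentz z ?Xv / (\<rho> u)\<^sup>2" for z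
  have expand: "z = a z *\<^sub>R ?Xu + b z *\<^sub>R ?Xv" if "lorentz z (N (u, v)) = 0" for z
    by (rule frame_eqI[OF u v])
       (use that metric[OF u v] metric'[OF u v] normal[OF u v] \<rho>_pos[OF u] lorentz_commute in
        \<open>auto simp: a_def b_def lorentz_simps\<close>)
  define M' :: "real ^ 2 ^ 2" where "M' = vector
    [vector [a (- partial_u N (u, v)), a (- partial_v N (u, v))],
     vector [b (- partial_u N (u, v)), b (- partial_v N (u, v))]]"
  have M': "- partial_u N (u, v) = M' $ 1 $ 1 *\<^sub>R ?Xu + M' $ 2 $ 1 *\<^sub>R ?Xv"
    "- partial_v N (u, v) = M' $ 1 $ 2 *\<^sub>R ?Xu + M' $ 2 $ 2 *\<^sub>R ?Xv"
    using expand[of "- partial_u N (u, v)"] expand[of "- partial_v N (u, v)"]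
      derivative_of_normal_tangential[OF u v]
    by (simp_all add: M'_def lorentz_simps vector_2)
  then have "M = M'" unfolding M_def by (rule weingarten_matrix_unique[OF u v])
  then show "- partial_u N (u, v) = M $ 1 $ 1 *\<^sub>R ?Xu + M $ 2 $ 1 *\<^sub>R ?Xv"
    "- partial_v N (u, v) = M $ 1 $ 2 *\<^sub>R ?Xu + M $ 2 $ 2 *\<^sub>R ?Xv"
    using M' by simp_all
qed

text \<open>In isothermal coordinates zero mean curvature is the Laplace equation (\<open>\<delta> = \<epsilon>\<close>) or the wave
equation (\<open>\<delta> = - \<epsilon>\<close>) for the position vector: the tangential part of the equation holds for
every metric of this form, and its normal part is the trace of the second fundamental form.
The right-hand side does not involve the normal, so the equation passes from one unit normal
field to any other.\<close>

lemma trace_weingarten_eq_0_iff: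
  assumes u: "u \<in> I" and v: "v \<in> J"
  shows "trace (weingarten_matrix X N (u, v)) = 0 \<longleftrightarrow>
    partial_v (partial_v X) (u, v) = - (\<delta> * \<epsilon>) *\<^sub>R partial_u (partial_u X) (u, v)"
proof -
  let ?M = "weingarten_matrix X N (u, v)"
  let ?Xuu = "partial_u (partial_u X) (u, v)" and ?Xvv = "partial_v (partial_v X) (u, v)"
  note M = weingarten_matrix_works[OF u v]
  have uu: "lorentz ?Xuu (N (u, v)) = \<delta> * (\<rho> u)\<^sup>2 * ?M $ 1 $ 1"
    using second_fundamental_form(1)[OF u v] metric[OF u v] metric'[OF u v]
      arg_cong[OF M(1), of "\<lambda>z. lorentz z (partial_u X (u, v))"]
    by (simp add: lorentz_simps)
  have vv: "lorentz ?Xvv (N (u, v)) = \<epsilon> * (\<rho> u)\<^sup>2 * ?M $ 2 $ 2"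
    using second_fundamental_form(2)[OF u v] metric[OF u v] metric'[OF u v]
      arg_cong[OF M(2), of "\<lambda>z. lorentz z (partial_v X (u, v))"]
    by (simp add: lorentz_simps)
  obtain \<rho>' where \<rho>': "(\<rho> has_real_derivative \<rho>') (at u)" using \<rho>_derivative[OF u] by blast
  note tan = tangential_second_derivatives[OF u v \<rho>']
  have "?Xvv = - (\<delta> * \<epsilon>) *\<^sub>R ?Xuu \<longleftrightarrow> lorentz ?Xvv (N (u, v)) = - (\<delta> * \<epsilon>) * lorentz ?Xuu (N (u, v))"
  proof
    assume *: "lorentz ?Xvv (N (u, v)) = - (\<delta> * \<epsilon>) * lorentz ?Xuu (N (u, v))"
    show "?Xvv = - (\<delta> * \<epsilon>) *\<^sub>R ?Xuu"
      by (rule frame_eqI[OF u v]) (use tan * \<delta> in \<open>auto simp: lorentz_simps\<close>)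
  qed (simp add: lorentz_simps)
  also have "\<dots> \<longleftrightarrow> \<epsilon> * (\<rho> u)\<^sup>2 * (?M $ 1 $ 1 + ?M $ 2 $ 2) = 0"
    unfolding uu vv using \<delta> by (auto simp: algebra_simps)
  also have "\<dots> \<longleftrightarrow> trace ?M = 0"
    using \<epsilon> \<rho>_pos[OF u] by (auto simp: trace_def sum_2)
  finally show ?thesis by blast
qed

lemma mean_curvature_eq_0_iff:
  assumes "u \<in> I" "v \<in> J"
  shows "mean_curvature X N (u, v) = 0 \<longleftrightarrow>
    partial_v (partial_v X) (u, v) = - (\<delta> * \<epsilon>) *\<^sub>R partial_u (partial_u X) (u, v)"
  unfolding trace_weingarten_eq_0_iff[OF assms, symmetric] mean_curvature_def
  using causal_sign_eq[OF assms] \<delta> \<epsilon> by auto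

end

section \<open>Lines of curvature along the coordinate lines\<close>

text \<open>The coordinate lines are lines of curvature with principal curvatures \<open>\<kappa>\<close> and \<open>- \<kappa>\<close>: twist zero
together with zero mean curvature.\<close>

locale curvature_line_surface = isothermal_surface_normal +
  fixes \<kappa> :: "real \<Rightarrow> real"
  assumes curvature_lines:
      "u \<in> I \<Longrightarrow> v \<in> J \<Longrightarrow> partial_u N (u, v) = - \<kappa> u *\<^sub>R partial_u X (u, v)"
      "u \<in> I \<Longrightarrow> v \<in> J \<Longrightarrow> partial_v N (u, v) = \<kappa> u *\<^sub>R partial_v X (u, v)"
begin

text \<open>Since the off-diagonal coefficient of the second fundamental form vanishes, the mixed derivative
of \<open>X\<close> is a multiple of its \<open>v\<close>-derivative. This excludes a translational part of the
symmetry along the axis, that is, helicoidal surfaces.\<close>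

lemma structure_equations:
  assumes u: "u \<in> I" and v: "v \<in> J" and \<rho>': "(\<rho> has_real_derivative \<rho>') (at u)"
  shows "partial_v (partial_u X) (u, v) = (\<rho>' / \<rho> u) *\<^sub>R partial_v X (u, v)"
    and "partial_v (partial_v X) (u, v) =
      - (\<delta> * \<epsilon> * \<rho>' / \<rho> u) *\<^sub>R partial_u X (u, v) + (\<delta> * \<kappa> u * (\<rho> u)\<^sup>2) *\<^sub>R N (u, v)"
proof -
  note tan = tangential_second_derivatives[OF u v \<rho>'] and sff = second_fundamental_form[OF u v]
  note basis = metric[OF u v] metric'[OF u v] normal[OF u v]
  have N: "lorentz (partial_u X (u, v)) (N (u, v)) = 0" "lorentz (partial_v X (u, v)) (N (u, v)) = 0"
    using normal(1,2)[OF u v] by (simp_all only: lorentz_commute)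
  have II: "lorentz (partial_v (partial_u X) (u, v)) (N (u, v)) = 0"
    "lorentz (partial_v (partial_v X) (u, v)) (N (u, v)) = - (\<kappa> u * (\<rho> u)\<^sup>2 * \<epsilon>)"
    using sff(2,3) unfolding curvature_lines[OF u v] by (simp_all add: lorentz_simps basis)
  have \<rho>: "\<rho> u \<noteq> 0" using \<rho>_pos[OF u] by simp
  show "partial_v (partial_u X) (u, v) = (\<rho>' / \<rho> u) *\<^sub>R partial_v X (u, v)"
    by (rule frame_eqI[OF u v]) (simp_all add: tan(3,4) II basis N lorentz_simps power2_eq_square \<rho>)
  show "partial_v (partial_v X) (u, v) =
      - (\<delta> * \<epsilon> * \<rho>' / \<rho> u) *\<^sub>R partial_u X (u, v) + (\<delta> * \<kappa> u * (\<rho> u)\<^sup>2) *\<^sub>R N (u, v)"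
    by (rule frame_eqI[OF u v])
       (simp_all add: tan(5,6) II basis N lorentz_simps power2_eq_square mult.assoc mult.commute mult.left_commute \<rho>)
qed

lemma trace_weingarten: "u \<in> I \<Longrightarrow> v \<in> J \<Longrightarrow> trace (weingarten_matrix X N (u, v)) = 0"
proof -
  assume u: "u \<in> I" and v: "v \<in> J"
  have "weingarten_matrix X N (u, v) = vector [vector [\<kappa> u, 0], vector [0, - \<kappa> u]]"
    by (rule weingarten_matrix_unique[OF u v]) (simp_all add: curvature_lines[OF u v] vector_2)
  then show ?thesis by (simp add: trace_def sum_2 vector_2)
qed

lemma zero_mean_curvature: "zero_mean_curvature (I \<times> J) X"
  using unit_normal by (auto simp: zero_mean_curvature_def mean_curvature_def trace_weingarten)

text \<open>The mixed derivative is proportional to \<open>X\<^sub>v\<close> with a factor depending on \<open>u\<close> only, so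
\<open>X\<^sub>v(u, v) = \<rho>(u) f(v)\<close> for a single curve \<open>f\<close> of vectors of constant square \<open>\<epsilon>\<close>. The structure
equations at a fixed \<open>u\<close> give \<open>f'' = m f\<close> with a constant \<open>m\<close>, hence the bivector \<open>f \<and> f'\<close> is
constant and, scaled by \<open>\<epsilon>\<close>, generates a group of linear rotations with \<open>B f = f'\<close>. Then \<open>X\<^sub>v - B X\<close>
is constant, and since \<open>X\<^sub>v\<close> is in the image of \<open>B\<close>, the origin can be moved so that
\<open>X\<^sub>v = B (X - x0)\<close>: the \<open>v\<close>-lines are orbits of rotations about an axis through \<open>x0\<close>.
If \<open>f' = 0\<close>, no rotation arises in this way; then \<open>X\<close> is an affine parametrization of a part of a
plane.\<close>

lemma surface_of_revolution: "surface_of_revolution (I \<times> J) X"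
proof -
  obtain u0 where u0: "u0 \<in> I" using nonempty by blast
  let ?Xu = "partial_u X" and ?Xv = "partial_v X" and ?Xvv = "partial_v (partial_v X)"
  have \<rho>0: "\<rho> u > 0" "\<rho> u \<noteq> 0" if "u \<in> I" for u using \<rho>_pos[OF that] by auto
  have "\<forall>u\<in>I. \<exists>d. (\<rho> has_real_derivative d) (at u)"
    by (rule ballI) (rule \<rho>_derivative)
  then obtain \<rho>' where \<rho>': "\<And>u. u \<in> I \<Longrightarrow> (\<rho> has_real_derivative \<rho>' u) (at u)"
    by (meson bchoice)
  note eqs = structure_equations[OF _ _ \<rho>']
  note scaled = bounded_linear.has_vector_derivative[OF bounded_linear_scaleR_right]
  define f where "f v = (1 / \<rho> u0) *\<^sub>R ?Xv (u0, v)" for v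
  define f' where "f' v = (1 / \<rho> u0) *\<^sub>R ?Xvv (u0, v)" for v

  have Xv: "?Xv (u, v) = \<rho> u *\<^sub>R f v" if u: "u \<in> I" and v: "v \<in> J" for u v
  proof -
    have "((\<lambda>u. (1 / \<rho> u) *\<^sub>R ?Xv (u, v)) has_vector_derivative 0) (at u)" if u: "u \<in> I" for u
    proof (rule has_vector_derivative_eq_rhs)
      show "((\<lambda>u. (1 / \<rho> u) *\<^sub>R ?Xv (u, v)) has_vector_derivative
          (1 / \<rho> u) *\<^sub>R partial_u ?Xv (u, v) + (- \<rho>' u / (\<rho> u * \<rho> u)) *\<^sub>R ?Xv (u, v)) (at u)"
        using u v \<rho>0[OF u]
        by (intro has_vector_derivative_scaleR smooth_on_partials(1)[OF smooth_partials(2)])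
           (auto intro!: derivative_eq_intros \<rho>')
      show "(1 / \<rho> u) *\<^sub>R partial_u ?Xv (u, v) + (- \<rho>' u / (\<rho> u * \<rho> u)) *\<^sub>R ?Xv (u, v) = 0"
        unfolding mixed_partials[OF u v, symmetric] eqs(1)[OF u v u] by simp
    qed
    then have "(1 / \<rho> u) *\<^sub>R ?Xv (u, v) = f v"
      unfolding f_def by (rule constant_if_derivative_0[OF interval_I _ u u0])
    then have "\<rho> u *\<^sub>R f v = \<rho> u *\<^sub>R (1 / \<rho> u) *\<^sub>R ?Xv (u, v)" by simp
    then show ?thesis using \<rho>0[OF u] by simp
  qed

  have df: "((\<lambda>v. f v) has_vector_derivative f' v) (at v)" if "v \<in> J" for v
  proof -
    show ?thesis unfolding f_def f'_def
      by (rule scaled, rule smooth_on_partials(2)[OF smooth_partials(2)]) (use u0 that in auto)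
  qed

  have Xvv: "?Xvv (u, v) = \<rho> u *\<^sub>R f' v" if u: "u \<in> I" and v: "v \<in> J" for u v
  proof -
    have "((\<lambda>v. ?Xv (u, v)) has_vector_derivative ?Xvv (u, v)) (at v)"
      by (rule smooth_on_partials(2)[OF smooth_partials(2)]) (use u v in auto)
    moreover have "((\<lambda>v. ?Xv (u, v)) has_vector_derivative \<rho> u *\<^sub>R f' v) (at v)"
      by (rule has_vector_derivative_transform_within_open[OF scaled[OF df[OF v]] open_J v]) (simp add: Xv u)
    ultimately show ?thesis by (rule vector_derivative_unique_at)
  qed

  have ff: "lorentz (f v) (f v) = \<epsilon>" "lorentz (f v) (f' v) = 0" "lorentz (f' v) (f v) = 0" if v: "v \<in> J" for v
    using metric(3)[OF u0 v] tangential_second_derivatives(6)[OF u0 v \<rho>'[OF u0]] \<rho>0[OF u0]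
      lorentz_commute[of "?Xv (u0, v)" "?Xvv (u0, v)"]
    by (simp_all add: f_def f'_def lorentz_simps power2_eq_square)

  show ?thesis
  proof (cases "\<exists>v0\<in>J. f' v0 \<noteq> 0")
    case True
    then obtain v0 where v0: "v0 \<in> J" and ne: "f' v0 \<noteq> 0" by blast
    define m where "m = - (\<delta> * \<epsilon> * (\<rho>' u0)\<^sup>2 / (\<rho> u0)\<^sup>2) + \<delta> * (\<kappa> u0)\<^sup>2 * (\<rho> u0)\<^sup>2"
    \<comment> \<open>By the structure equations \<open>f'\<close> is, for fixed \<open>u0\<close>, a combination of \<open>X\<^sub>u\<close> and \<open>N\<close> with
        coefficients independent of \<open>v\<close>, and both have \<open>v\<close>-derivatives proportional to \<open>f\<close>.\<close>
    have ddf: "(f' has_vector_derivative m *\<^sub>R f v) (at v)" if v: "v \<in> J" for v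
    proof -
      let ?a = "- (\<delta> * \<epsilon> * \<rho>' u0 / (\<rho> u0)\<^sup>2)" and ?b = "\<delta> * \<kappa> u0 * \<rho> u0"
      have 1: "((\<lambda>v. ?a *\<^sub>R ?Xu (u0, v) + ?b *\<^sub>R N (u0, v)) has_vector_derivative
          ?a *\<^sub>R partial_v ?Xu (u0, v) + ?b *\<^sub>R partial_v N (u0, v)) (at v)"
        using u0 v
        by (intro has_vector_derivative_add scaled smooth_on_partials(2)[OF smooth_partials(1)]
            smooth_on_partials(2)[OF smooth_N]) auto
      have 2: "?a *\<^sub>R ?Xu (u0, y) + ?b *\<^sub>R N (u0, y) = f' y" if "y \<in> J" for y
      proof -
        have "?a = 1 / \<rho> u0 * - (\<delta> * \<epsilon> * \<rho>' u0 / \<rho> u0)" "?b = 1 / \<rho> u0 * (\<delta> * \<kappa> u0 * (\<rho> u0)\<^sup>2)"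
          using \<rho>0[OF u0] by (simp_all add: power2_eq_square)
        then show ?thesis
          unfolding f'_def eqs(2)[OF u0 that u0] by (simp only: scaleR_add_right scaleR_scaleR)
      qed
      have 3: "?a *\<^sub>R partial_v ?Xu (u0, v) + ?b *\<^sub>R partial_v N (u0, v) = m *\<^sub>R f v"
      proof -
        have "?a * (\<rho>' u0 / \<rho> u0 * \<rho> u0) + ?b * (\<kappa> u0 * \<rho> u0) = m"
          using \<rho>0[OF u0] by (simp add: m_def power2_eq_square)
        then show ?thesis
          unfolding eqs(1)[OF u0 v u0] curvature_lines(2)[OF u0 v] Xv[OF u0 v]
          by (simp only: scaleR_add_left[symmetric] scaleR_scaleR)
      qed
      show ?thesis
        by (rule has_vector_derivative_transform_within_open[OF has_vector_derivative_eq_rhs[OF 1 3] open_J v 2])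
    qed

    define F where "F = f v0"
    define G where "G = \<epsilon> *\<^sub>R f' v0"
    let ?B = "wedge F G"
    \<comment> \<open>The derivative of \<open>f \<and> f'\<close> is \<open>f' \<and> f' + f \<and> m f = 0\<close>.\<close>
    have B: "?B x = wedge (f v) (\<epsilon> *\<^sub>R f' v) x" if v: "v \<in> J" for v x
    proof -
      have "((\<lambda>v. lorentz (f v) x *\<^sub>R (\<epsilon> *\<^sub>R f' v) - lorentz (\<epsilon> *\<^sub>R f' v) x *\<^sub>R f v) has_vector_derivative 0) (at v)"
        if v: "v \<in> J" for v
      proof -
        have ef: "((\<lambda>v. \<epsilon> *\<^sub>R f' v) has_vector_derivative \<epsilon> *\<^sub>R m *\<^sub>R f v) (at v)"
          by (rule bounded_linear.has_vector_derivative[OF bounded_linear_scaleR_right ddf[OF v]])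
        have l: "((\<lambda>v. lorentz (y v) x) has_real_derivative lorentz y' x) (at v)"
          if "(y has_vector_derivative y') (at v)" for y y'
          using bounded_linear.has_vector_derivative[OF lorentz.bounded_linear_left that]
          by (simp add: has_real_derivative_iff_has_vector_derivative)
        show ?thesis
          by (rule has_vector_derivative_eq_rhs[OF has_vector_derivative_diff[OF
              has_vector_derivative_scaleR[OF l[OF df[OF v]] ef] has_vector_derivative_scaleR[OF l[OF ef] df[OF v]]]])
             (simp add: lorentz_simps mult.commute mult.left_commute)
      qed
      from constant_if_derivative_0[OF interval_J this v0 v]
      show ?thesis by (simp add: wedge_def F_def G_def)
    qed
    have FG: "lorentz F G = 0" using ff[OF v0] by (simp add: F_def G_def lorentz_simps)
    have BF: "?B F = f' v0" using ff[OF v0] by (simp add: wedge_def F_def G_def lorentz_simps)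
    have BXv: "?B (?Xv (u, v)) = ?Xvv (u, v)" if "u \<in> I" "v \<in> J" for u v
      unfolding B[OF that(2)] Xv[OF that] Xvv[OF that] using ff[OF that(2)]
      by (simp add: wedge_def lorentz_simps)
    have BXu: "?B (?Xu (u, v)) = partial_v ?Xu (u, v)" if u: "u \<in> I" and v: "v \<in> J" for u v
    proof -
      have "\<rho> u * lorentz (f v) (?Xu (u, v)) = 0"
        using metric'[OF u v] unfolding Xv[OF u v] by (simp add: lorentz_simps)
      moreover have "\<rho> u * lorentz (f' v) (?Xu (u, v)) = \<rho> u * - (\<epsilon> * \<rho>' u)"
        using tangential_second_derivatives(5)[OF u v \<rho>'[OF u]] unfolding Xvv[OF u v] by (simp add: lorentz_simps)
      ultimately have "lorentz (f v) (?Xu (u, v)) = 0" "lorentz (f' v) (?Xu (u, v)) = - (\<epsilon> * \<rho>' u)"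
        using \<rho>0(2)[OF u] unfolding mult_cancel_left mult_eq_0_iff by simp_all
      then show ?thesis
        unfolding B[OF v] eqs(1)[OF u v u] Xv[OF u v] using \<rho>0[OF u]
        by (simp add: wedge_def lorentz_simps)
    qed

    \<comment> \<open>The infinitesimal symmetry \<open>X\<^sub>v\<close> is the affine vector field \<open>B X + D\<close>.\<close>
    define D where "D p = ?Xv p - ?B (X p)" for p
    note dB = bounded_linear.has_vector_derivative[OF bounded_linear_wedge]
    have D: "D (u, v) = D (u0, v0)" if u: "u \<in> I" and v: "v \<in> J" for u v
    proof -
      have "((\<lambda>u. D (u, v)) has_vector_derivative 0) (at u)" if u: "u \<in> I" for u
        unfolding D_def
        by (rule has_vector_derivative_eq_rhs[OF has_vector_derivative_diff[OF
            smooth_on_partials(1)[OF smooth_partials(2)] dB[OF smooth_on_partials(1)[OF smooth]]]])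
           (use u v BXu mixed_partials in auto)
      then have "D (u, v) = D (u0, v)" by (rule constant_if_derivative_0[OF interval_I _ u u0])
      moreover have "((\<lambda>v. D (u0, v)) has_vector_derivative 0) (at v)" if "v \<in> J" for v
        unfolding D_def
        by (rule has_vector_derivative_eq_rhs[OF has_vector_derivative_diff[OF
            smooth_on_partials(2)[OF smooth_partials(2)] dB[OF smooth_on_partials(2)[OF smooth]]]])
           (use u0 that BXv in auto)
      then have "D (u0, v) = D (u0, v0)" by (rule constant_if_derivative_0[OF interval_J _ v v0])
      ultimately show ?thesis by simp
    qed

    \<comment> \<open>A preimage \<open>z\<close> of \<open>X\<^sub>v\<close> under \<open>B\<close> at one point: make \<open>y\<close> orthogonal to \<open>F\<close>, which leaves its
        product with \<open>f' v0\<close> unchanged, and rescale.\<close>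
    obtain y where y: "lorentz (f' v0) y \<noteq> 0" using lorentz_nondegenerate ne by blast
    define z where "z = (- \<epsilon> * \<rho> u0 / lorentz (f' v0) y) *\<^sub>R (y - (\<epsilon> * lorentz F y) *\<^sub>R F)"
    have "lorentz F z = 0" using ff[OF v0] by (simp add: z_def F_def lorentz_simps mult.left_commute)
    moreover have "lorentz G z = - \<rho> u0"
      using ff[OF v0] y by (simp add: z_def F_def G_def lorentz_simps)
    ultimately have Bz: "?B z = ?Xv (u0, v0)" by (simp add: wedge_def Xv[OF u0 v0] F_def)
    define x0 where "x0 = X (u0, v0) - z"
    have BX: "?B (X (u, v) - x0) = ?Xv (u, v)" if "u \<in> I" "v \<in> J" for u v
      using D[OF that] Bz by (simp add: x0_def D_def wedge_diff wedge_add algebra_simps)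
    have orbit: "X (u, v) = x0 + rot F G (v - v0) (X (u, v0) - x0)" if u: "u \<in> I" and v: "v \<in> J" for u v
    proof -
      have "X (u, v) - x0 = rot F G (v - v0) (X (u, v0) - x0)"
      proof (rule rot_unique[OF FG interval_J v v0])
        show "((\<lambda>v. X (u, v) - x0) has_vector_derivative ?B (X (u, v) - x0)) (at v)" if "v \<in> J" for v
          by (rule has_vector_derivative_eq_rhs[OF has_vector_derivative_diff[OF
              smooth_on_partials(2)[OF smooth] has_vector_derivative_const]])
             (use u that BX in auto)
      qed
      then show ?thesis by (simp add: algebra_simps)
    qed
    have "vector_derivative (\<lambda>s. X (s, v0)) (at s) \<noteq> 0" if s: "s \<in> I" for s
    proof -
      have "vector_derivative (\<lambda>s. X (s, v0)) (at s) = ?Xu (s, v0)"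
        by (rule vector_derivative_at[OF smooth_on_partials(1)[OF smooth]]) (use s v0 in auto)
      moreover have "?Xu (s, v0) \<noteq> 0"
        using metric(1)[OF s v0] \<rho>0[OF s] \<delta> by (auto simp: lorentz.zero_left)
      ultimately show ?thesis by simp
    qed
    moreover have "smooth_on I (\<lambda>s. X (s, v0))" by (rule smooth_on_slice[OF open_I smooth v0])
    moreover have "rotation_group (\<lambda>t x. x0 + rot F G t (x - x0))"
      by (rule rotation_group_rot[OF FG, of F]) (simp add: BF ne)
    moreover have "\<forall>p\<in>I \<times> J. \<exists>t. \<exists>s\<in>I. X p = x0 + rot F G t (X (s, v0) - x0)"
      using orbit by blast
    ultimately show ?thesis unfolding surface_of_revolution_def using nondegenerate I by blast
  next
    case False
    obtain v0 where v0: "v0 \<in> J" using nonempty by blast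
    have Xvv0: "?Xvv (u, v) = 0" if "u \<in> I" "v \<in> J" for u v
      using Xvv[OF that] False that by simp
    have \<rho>'0: "\<rho>' u = 0" if "u \<in> I" for u
      using tangential_second_derivatives(5)[OF that v0 \<rho>'[OF that]] \<rho>0[OF that] \<epsilon>
      by (auto simp: Xvv0[OF that v0] lorentz.zero_left)
    have Xuv0: "partial_v ?Xu (u, v) = 0" if "u \<in> I" "v \<in> J" for u v
      using eqs(1)[OF that that(1)] \<rho>'0[OF that(1)] by simp
    have Xuu0: "partial_u ?Xu (u, v) = 0" if "u \<in> I" "v \<in> J" for u v
      using trace_weingarten_eq_0_iff[OF that] trace_weingarten[OF that] Xvv0[OF that] \<delta> \<epsilon> by auto
    have const: "P (u, v) = P (u0, v0)"
      if P: "smooth_on (I \<times> J) P" "\<And>u v. u \<in> I \<Longrightarrow> v \<in> J \<Longrightarrow> partial_u P (u, v) = 0"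
        "\<And>u v. u \<in> I \<Longrightarrow> v \<in> J \<Longrightarrow> partial_v P (u, v) = 0" and u: "u \<in> I" and v: "v \<in> J"
      for P :: "real \<times> real \<Rightarrow> real ^ 3" and u v
    proof -
      have "P (u, v) = P (u0, v)"
        by (rule constant_if_derivative_0[OF interval_I _ u u0], rule has_vector_derivative_eq_rhs[OF smooth_on_partials(1)[OF P(1)]])
           (use P(2) v in auto)
      also have "\<dots> = P (u0, v0)"
        by (rule constant_if_derivative_0[OF interval_J _ v v0], rule has_vector_derivative_eq_rhs[OF smooth_on_partials(2)[OF P(1)]])
           (use P(3) u0 in auto)
      finally show ?thesis .
    qed
    define A where "A = ?Xu (u0, v0)"
    define E where "E = ?Xv (u0, v0)"
    have Xu_const: "?Xu (u, v) = A" and Xv_const: "?Xv (u, v) = E" if "u \<in> I" "v \<in> J" for u v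
      unfolding A_def E_def
      by (rule const[OF smooth_partials(1) Xuu0 Xuv0 that] const[OF smooth_partials(2) _ Xvv0 that];
          simp add: mixed_partials[symmetric] Xuv0)+
    define a where "a = X (u0, v0)"
    have affine: "X (u, v) = a + (u - u0) *\<^sub>R A + (v - v0) *\<^sub>R E" if u: "u \<in> I" and v: "v \<in> J" for u v
    proof -
      have "X (u, v) - (u - u0) *\<^sub>R A - (v - v0) *\<^sub>R E = X (u0, v) - (u0 - u0) *\<^sub>R A - (v - v0) *\<^sub>R E"
        by (rule constant_if_derivative_0[OF interval_I _ u u0, of "\<lambda>u. X (u, v) - (u - u0) *\<^sub>R A - (v - v0) *\<^sub>R E"])
           (use v Xu_const in \<open>auto intro!: derivative_eq_intros smooth_on_partials(1)[OF smooth]\<close>)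
      also have "\<dots> = X (u0, v0) - (v0 - v0) *\<^sub>R E"
      proof -
        have "X (u0, v) - (v - v0) *\<^sub>R E = X (u0, v0) - (v0 - v0) *\<^sub>R E"
          by (rule constant_if_derivative_0[OF interval_J _ v v0, of "\<lambda>v. X (u0, v) - (v - v0) *\<^sub>R E"])
             (use u0 Xv_const in \<open>auto intro!: derivative_eq_intros smooth_on_partials(2)[OF smooth]\<close>)
        then show ?thesis by simp
      qed
      finally show ?thesis by (simp add: a_def algebra_simps)
    qed
    let ?r = "\<rho> u0"
    have "lorentz ((1 / ?r) *\<^sub>R A) ((1 / ?r) *\<^sub>R A) = \<delta>" "lorentz ((1 / ?r) *\<^sub>R E) ((1 / ?r) *\<^sub>R E) = \<epsilon>"
      "lorentz ((1 / ?r) *\<^sub>R A) ((1 / ?r) *\<^sub>R E) = 0"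
      using metric[OF u0 v0] \<rho>0[OF u0] by (simp_all add: A_def E_def lorentz_simps power2_eq_square)
    from plane_swept_by_rotations[OF \<delta> \<epsilon> signs this, of a]
    obtain \<phi> \<gamma> where \<phi>: "rotation_group \<phi>" "smooth_on UNIV \<gamma>" "\<And>s. vector_derivative \<gamma> (at s) \<noteq> 0"
      and orbit: "\<And>p q. \<exists>t s. a + p *\<^sub>R (1 / ?r) *\<^sub>R A + q *\<^sub>R (1 / ?r) *\<^sub>R E = \<phi> t (\<gamma> s)" by metis
    have "\<exists>t. \<exists>s\<in>UNIV. X (u, v) = \<phi> t (\<gamma> s)" if "u \<in> I" "v \<in> J" for u v
      using orbit[of "(u - u0) * ?r" "(v - v0) * ?r"] \<rho>0[OF u0] by (simp add: affine[OF that])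
    moreover have "open_interval (UNIV :: real set)" by (simp add: open_interval_def)
    ultimately show ?thesis
      unfolding surface_of_revolution_def using nondegenerate \<phi> by blast
  qed
qed

end

section \<open>Associate surfaces\<close>

lemma frechet_derivative_linear_combination:
  assumes "smooth_on S f" "smooth_on S g" "x \<in> S"
  shows "frechet_derivative (\<lambda>x. a *\<^sub>R f x + b *\<^sub>R g x) (at x) w =
    a *\<^sub>R frechet_derivative f (at x) w + b *\<^sub>R frechet_derivative g (at x) w"
proof -
  have "((\<lambda>x. a *\<^sub>R f x + b *\<^sub>R g x) has_derivative
      (\<lambda>w. a *\<^sub>R frechet_derivative f (at x) w + b *\<^sub>R frechet_derivative g (at x) w)) (at x)"
    by (intro derivative_intros smooth_on_has_derivative[OF assms(1,3)] smooth_on_has_derivative[OF assms(2,3)])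
  from frechet_derivative_at[OF this] show ?thesis by metis
qed

text \<open>The Cauchy-Riemann equations, for each coordinate.\<close>

lemma conjugate_mapI:
  assumes "open U" "smooth_on U Y" "smooth_on U W"
    and CR: "\<And>p. p \<in> U \<Longrightarrow> partial_u W p = - partial_v Y p" "\<And>p. p \<in> U \<Longrightarrow> partial_v W p = partial_u Y p"
  shows "conjugate_map U Y W"
  unfolding conjugate_map_def
proof
  fix i
  have coords: "((\<lambda>z. (Re z, Im z)) has_derivative (\<lambda>w. (Re w, Im w))) (at z)" for z
    by (intro has_derivative_Pair bounded_linear_imp_has_derivative bounded_linear_Re bounded_linear_Im)
  have comp: "((\<lambda>z. G (Re z, Im z) $ i) has_derivative
      (\<lambda>w. Re w * partial_u G (Re z, Im z) $ i + Im w * partial_v G (Re z, Im z) $ i)) (at z)"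
    if G: "smooth_on U G" and z: "(Re z, Im z) \<in> U" for G :: "real \<times> real \<Rightarrow> real ^ 3" and z
  proof -
    note dG = smooth_on_has_derivative[OF G z]
    have "((\<lambda>z. G (Re z, Im z)) has_derivative (\<lambda>w. frechet_derivative G (at (Re z, Im z)) (Re w, Im w))) (at z)"
      using diff_chain_at[OF coords dG] by (simp add: o_def)
    from bounded_linear.has_derivative[OF bounded_linear_vec_nth this, of i] show ?thesis
      by (rule has_derivative_eq_rhs)
         (subst derivative_by_partials[OF has_derivative_linear[OF dG]], simp)
  qed
  have "((\<lambda>z. Complex (Y (Re z, Im z) $ i) (W (Re z, Im z) $ i)) has_field_derivative
      Complex (partial_u Y (Re z, Im z) $ i) (- partial_v Y (Re z, Im z) $ i)) (at z)"
    if z: "(Re z, Im z) \<in> U" for z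
    unfolding has_field_derivative_def Complex_eq
    by (rule has_derivative_eq_rhs[OF has_derivative_add[OF has_derivative_of_real[OF comp[OF assms(2) z]]
          has_derivative_mult_right[OF has_derivative_of_real[OF comp[OF assms(3) z]]]]])
       (auto simp: CR[OF z] fun_eq_iff complex_eq_iff algebra_simps)
  then show "(\<lambda>z. Complex (Y (Re z, Im z) $ i) (W (Re z, Im z) $ i)) holomorphic_on {z. (Re z, Im z) \<in> U}"
    unfolding holomorphic_on_def field_differentiable_def
    using has_field_derivative_at_within by blast
qed

lemma rot_mat_conjugate_diag:
  "rot_mat (- c) ** diag_mat a b ** rot_mat c =
    vector [vector [a * (cos c)\<^sup>2 + b * (sin c)\<^sup>2, (b - a) * (sin c * cos c)],
            vector [(b - a) * (sin c * cos c), a * (sin c)\<^sup>2 + b * (cos c)\<^sup>2]]"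
  by (simp add: rot_mat_def diag_mat_def matrix_matrix_mult_def vec_eq_iff forall_2 sum_2 vector_2
      power2_eq_square algebra_simps)

lemma boost_mat_conjugate_diag:
  "boost_mat (- c) ** diag_mat a b ** boost_mat c =
    vector [vector [a * (cosh c)\<^sup>2 - b * (sinh c)\<^sup>2, (a - b) * (sinh c * cosh c)],
            vector [(b - a) * (sinh c * cosh c), b * (cosh c)\<^sup>2 - a * (sinh c)\<^sup>2]]"
  by (simp add: boost_mat_def diag_mat_def matrix_matrix_mult_def vec_eq_iff forall_2 sum_2 vector_2
      power2_eq_square algebra_simps)

text \<open>Conjugating \<open>diag(a, -a)\<close> by the angle \<open>c\<close> produces the double angle \<open>2 c\<close>: a reflection-like matrix
turned twice as fast. The factor \<open>\<tau>\<close> is \<open>1\<close> for circular and \<open>- 1\<close> for hyperbolic functions.\<close>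

lemma twisted_traceless_matrix:
  fixes M :: "real ^ 2 ^ 2"
  assumes "\<tau> = 1 \<and> M = rot_mat (- c) ** diag_mat a b ** rot_mat c \<or>
      \<tau> = - 1 \<and> M = boost_mat (- c) ** diag_mat a b ** boost_mat c"
    and "C = (if \<tau> = 1 then cos (2 * c) else cosh (2 * c))"
    and "S = (if \<tau> = 1 then sin (2 * c) else sinh (2 * c))"
    and "trace M = 0"
  shows "M $ 1 $ 1 = a * C" "M $ 2 $ 1 = - (a * S)" "M $ 1 $ 2 = - (\<tau> * a * S)" "M $ 2 $ 2 = - (a * C)"
proof -
  have "M $ 1 $ 1 = a * C \<and> M $ 2 $ 1 = - (a * S) \<and> M $ 1 $ 2 = - (\<tau> * a * S) \<and> M $ 2 $ 2 = - (a * C)"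
    using assms(1)
  proof
    assume *: "\<tau> = 1 \<and> M = rot_mat (- c) ** diag_mat a b ** rot_mat c"
    then have M: "M = vector [vector [a * (cos c)\<^sup>2 + b * (sin c)\<^sup>2, (b - a) * (sin c * cos c)],
            vector [(b - a) * (sin c * cos c), a * (sin c)\<^sup>2 + b * (cos c)\<^sup>2]]"
      by (simp add: rot_mat_conjugate_diag)
    have "trace M = (a + b) * ((sin c)\<^sup>2 + (cos c)\<^sup>2)"
      unfolding M trace_def sum_2 vector_2 by algebra
    then have b: "b = - a" using assms(4) by simp
    have C: "C = (cos c)\<^sup>2 - (sin c)\<^sup>2" "S = 2 * sin c * cos c" "\<tau> = 1"
      using * assms(2,3) by (simp_all add: cos_double sin_double)
    show ?thesis unfolding M C b by (simp add: vector_2 algebra_simps)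
  next
    assume *: "\<tau> = - 1 \<and> M = boost_mat (- c) ** diag_mat a b ** boost_mat c"
    then have M: "M = vector [vector [a * (cosh c)\<^sup>2 - b * (sinh c)\<^sup>2, (a - b) * (sinh c * cosh c)],
            vector [(b - a) * (sinh c * cosh c), b * (cosh c)\<^sup>2 - a * (sinh c)\<^sup>2]]"
      by (simp add: boost_mat_conjugate_diag)
    have "trace M = (a + b) * ((cosh c)\<^sup>2 - (sinh c)\<^sup>2)"
      unfolding M by (simp add: trace_def sum_2 vector_2 algebra_simps)
    then have b: "b = - a" using assms(4) by (simp add: hyperbolic_pythagoras)
    have C: "C = (cosh c)\<^sup>2 + (sinh c)\<^sup>2" "S = 2 * sinh c * cosh c" "\<tau> = - 1"
      using * assms(2,3) by (simp_all add: cosh_double sinh_double)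
    show ?thesis unfolding M C b by (simp add: vector_2 algebra_simps)
  qed
  then show "M $ 1 $ 1 = a * C" "M $ 2 $ 1 = - (a * S)" "M $ 1 $ 2 = - (\<tau> * a * S)" "M $ 2 $ 2 = - (a * C)"
    by blast+
qed

section \<open>Zero mean curvature and constant twist\<close>

text \<open>The member of the associate family at parameter \<open>\<plusminus>2 c\<close> has the same Gauss map and the same metric,
and its coordinate lines are lines of curvature. With \<open>Z\<^sub>u = - X\<^sub>v\<close>, \<open>Z\<^sub>v = \<tau> X\<^sub>u\<close> the map \<open>Z\<close> is the
conjugate of \<open>X\<close> if \<open>\<tau> = 1\<close> and minus its paraconjugate if \<open>\<tau> = - 1\<close>, and the two cases share all
formulas: \<open>Y = C X + S Z\<close>, \<open>W = C Z - \<tau> S X\<close> and \<open>X = C Y - S W\<close>, where \<open>W\<close> plays for \<open>Y\<close> the role of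
\<open>Z\<close> for \<open>X\<close>.\<close>

theorem theorem3p11:
  fixes X :: "real \<times> real \<Rightarrow> real ^ 3" and I J :: "real set" and c :: real
  assumes "intrinsic_rotational_surface I J X"
    and "zero_mean_curvature (I \<times> J) X"
    and "has_twist I J X (\<lambda>v. c)"
  shows "\<exists>Y. surface_of_revolution (I \<times> J) Y \<and> zero_mean_curvature (I \<times> J) Y \<and>
             associate_surface (I \<times> J) Y X"
proof -
  obtain \<delta> \<epsilon> \<rho> where "isothermal_surface I J X \<delta> \<epsilon> \<rho>"
    using assms(1)
    unfolding intrinsic_rotational_surface_def isothermal_surface_def fundform1_def nondegenerate_surface_def
      spacelike_surface_def timelike_surface_def by blast
  then interpret X: isothermal_surface I J X \<delta> \<epsilon> \<rho> .
  define \<tau> where "\<tau> = \<delta> * \<epsilon>"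
  have \<tau>: "\<tau> = 1 \<or> \<tau> = - 1" "\<tau> * \<tau> = 1" "\<epsilon> = \<tau> * \<delta>" using X.\<delta> X.\<epsilon> by (auto simp: \<tau>_def)
  let ?Xu = "partial_u X" and ?Xv = "partial_v X"

  have harmonic: "partial_v ?Xv (u, v) = - \<tau> *\<^sub>R partial_u ?Xu (u, v)" if "u \<in> I" "v \<in> J" for u v
  proof -
    obtain N0 where N0: "unit_normal_field (I \<times> J) X N0" "\<forall>p\<in>I \<times> J. mean_curvature X N0 p = 0"
      using assms(2) by (auto simp: zero_mean_curvature_def)
    interpret N0: isothermal_surface_normal I J X \<delta> \<epsilon> \<rho> N0
      using N0(1) by unfold_locales
    show ?thesis using N0(2) that N0.mean_curvature_eq_0_iff[OF that] by (simp add: \<tau>_def)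
  qed

  obtain N \<kappa>\<^sub>1 \<kappa>\<^sub>2 where N: "unit_normal_field (I \<times> J) X N"
    and twist: "\<And>u v. u \<in> I \<Longrightarrow> v \<in> J \<Longrightarrow>
      \<tau> = 1 \<and> weingarten_matrix X N (u, v) = rot_mat (- c) ** diag_mat (\<kappa>\<^sub>1 u) (\<kappa>\<^sub>2 u) ** rot_mat c \<or>
      \<tau> = - 1 \<and> weingarten_matrix X N (u, v) = boost_mat (- c) ** diag_mat (\<kappa>\<^sub>1 u) (\<kappa>\<^sub>2 u) ** boost_mat c"
    using assms(3) unfolding has_twist_def X.spacelike_surface_iff X.timelike_surface_iff \<tau>_def by blast
  interpret XN: isothermal_surface_normal I J X \<delta> \<epsilon> \<rho> N
    using N by unfold_locales
  define C where "C = (if \<tau> = 1 then cos (2 * c) else cosh (2 * c))"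
  define S where "S = (if \<tau> = 1 then sin (2 * c) else sinh (2 * c))"
  have CS: "C * C + \<tau> * (S * S) = 1"
    using \<tau>(1) sin_cos_squared_add[of "2 * c"] hyperbolic_pythagoras[of "2 * c"]
    by (auto simp: C_def S_def power2_eq_square)
  have Nu: "partial_u N (u, v) = - \<kappa>\<^sub>1 u *\<^sub>R (C *\<^sub>R ?Xu (u, v) - S *\<^sub>R ?Xv (u, v))"
    and Nv: "partial_v N (u, v) = \<kappa>\<^sub>1 u *\<^sub>R (C *\<^sub>R ?Xv (u, v) + (\<tau> * S) *\<^sub>R ?Xu (u, v))"
    if u: "u \<in> I" and v: "v \<in> J" for u v
  proof -
    have "trace (weingarten_matrix X N (u, v)) = 0"
      using XN.trace_weingarten_eq_0_iff[OF u v] harmonic[OF u v] by (simp add: \<tau>_def)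
    note M = twisted_traceless_matrix[OF twist[OF u v] C_def S_def this]
    have "partial_u N (u, v) = - ((\<kappa>\<^sub>1 u * C) *\<^sub>R ?Xu (u, v) + (- (\<kappa>\<^sub>1 u * S)) *\<^sub>R ?Xv (u, v))"
      using arg_cong[OF XN.weingarten_matrix_works(1)[OF u v], of uminus] unfolding M by simp
    then show "partial_u N (u, v) = - \<kappa>\<^sub>1 u *\<^sub>R (C *\<^sub>R ?Xu (u, v) - S *\<^sub>R ?Xv (u, v))"
      by (simp add: algebra_simps)
    have "partial_v N (u, v) = - ((- (\<tau> * \<kappa>\<^sub>1 u * S)) *\<^sub>R ?Xu (u, v) + (- (\<kappa>\<^sub>1 u * C)) *\<^sub>R ?Xv (u, v))"
      using arg_cong[OF XN.weingarten_matrix_works(2)[OF u v], of uminus] unfolding M by simp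
    then show "partial_v N (u, v) = \<kappa>\<^sub>1 u *\<^sub>R (C *\<^sub>R ?Xv (u, v) + (\<tau> * S) *\<^sub>R ?Xu (u, v))"
      by (simp add: algebra_simps)
  qed

  \<comment> \<open>The trivial summands give both coefficients the shape of a linear combination of smooth maps.\<close>
  let ?P = "\<lambda>p. (- 1) *\<^sub>R ?Xv p + 0 *\<^sub>R ?Xv p" and ?Q = "\<lambda>p. \<tau> *\<^sub>R ?Xu p + 0 *\<^sub>R ?Xu p"
  have P: "smooth_on (I \<times> J) ?P" and Q: "smooth_on (I \<times> J) ?Q"
    by (intro smooth_on_linear_combination X.open_domain X.smooth_partials)+
  have "partial_v ?P p = partial_u ?Q p" if "p \<in> I \<times> J" for p
    unfolding frechet_derivative_linear_combination[OF X.smooth_partials(2) X.smooth_partials(2) that]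
      frechet_derivative_linear_combination[OF X.smooth_partials(1) X.smooth_partials(1) that]
    using that harmonic by auto
  then obtain Z where Z: "\<And>p. p \<in> I \<times> J \<Longrightarrow> (Z has_derivative (\<lambda>w. fst w *\<^sub>R ?P p + snd w *\<^sub>R ?Q p)) (at p)"
    using closed_form_has_primitive[OF X.open_domain X.convex_domain P Q] by blast
  have smooth_Z: "smooth_on (I \<times> J) Z"
    by (rule smooth_on_of_derivative[OF X.open_domain Z]) (assumption, intro smooth_on_linear_combination X.open_domain P Q)
  have Zu: "partial_u Z p = - ?Xv p" and Zv: "partial_v Z p = \<tau> *\<^sub>R ?Xu p" if "p \<in> I \<times> J" for p
    using fun_cong[OF frechet_derivative_at[OF Z[OF that]], symmetric] by simp_all

  define Y where "Y p = C *\<^sub>R X p + S *\<^sub>R Z p" for p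
  define W where "W p = C *\<^sub>R Z p + (- (\<tau> * S)) *\<^sub>R X p" for p
  have smooth_Y: "smooth_on (I \<times> J) Y" and smooth_W: "smooth_on (I \<times> J) W"
    unfolding Y_def W_def by (intro smooth_on_linear_combination X.open_domain X.smooth smooth_Z)+
  have Yu: "partial_u Y p = C *\<^sub>R ?Xu p - S *\<^sub>R ?Xv p"
    and Yv: "partial_v Y p = C *\<^sub>R ?Xv p + (\<tau> * S) *\<^sub>R ?Xu p"
    and Wu: "partial_u W p = - partial_v Y p"
    and Wv: "partial_v W p = \<tau> *\<^sub>R partial_u Y p" if p: "p \<in> I \<times> J" for p
    unfolding Y_def W_def frechet_derivative_linear_combination[OF X.smooth smooth_Z p]
      frechet_derivative_linear_combination[OF smooth_Z X.smooth p] Zu[OF p] Zv[OF p]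
    by (simp_all add: algebra_simps)
  have X_eq: "X p = C *\<^sub>R Y p - S *\<^sub>R W p" for p
  proof -
    have "C *\<^sub>R Y p - S *\<^sub>R W p = (C * C + \<tau> * (S * S)) *\<^sub>R X p"
      by (simp add: Y_def W_def algebra_simps)
    then show ?thesis by (simp add: CS)
  qed

  interpret Y: isothermal_surface I J Y \<delta> \<epsilon> \<rho>
  proof
    fix u v assume u: "u \<in> I" and v: "v \<in> J"
    then have p: "(u, v) \<in> I \<times> J" by simp
    note m = X.metric[OF u v] X.metric'[OF u v]
    have "lorentz (partial_u Y (u, v)) (partial_u Y (u, v)) = (\<rho> u)\<^sup>2 * \<delta> * (C * C + \<tau> * (S * S))"
      unfolding Yu[OF p] by (simp add: lorentz_simps m \<tau>(3) algebra_simps)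
    then show "lorentz (partial_u Y (u, v)) (partial_u Y (u, v)) = (\<rho> u)\<^sup>2 * \<delta>" by (simp add: CS)
    show "lorentz (partial_u Y (u, v)) (partial_v Y (u, v)) = 0"
      unfolding Yu[OF p] Yv[OF p] by (simp add: lorentz_simps m \<tau>(3))
    have "lorentz (partial_v Y (u, v)) (partial_v Y (u, v)) = (\<rho> u)\<^sup>2 * (\<tau> * \<delta>) * (C * C) + (\<rho> u)\<^sup>2 * \<delta> * (\<tau> * \<tau> * (S * S))"
      unfolding Yv[OF p] by (simp add: lorentz_simps m \<tau>(3) algebra_simps)
    also have "\<dots> = (\<rho> u)\<^sup>2 * (\<tau> * \<delta>) * (C * C + \<tau> * (S * S))" by (simp add: algebra_simps)
    finally show "lorentz (partial_v Y (u, v)) (partial_v Y (u, v)) = (\<rho> u)\<^sup>2 * \<epsilon>" by (simp add: CS \<tau>(3))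
  qed (use X.I X.J X.\<delta> X.\<epsilon> X.signs X.smooth_\<rho> X.\<rho>_pos smooth_Y in auto)

  have N_Y: "unit_normal_field (I \<times> J) Y N"
    unfolding unit_normal_field_def
  proof (intro conjI ballI allI)
    fix p w assume p: "p \<in> I \<times> J"
    then obtain u v where uv: "p = (u, v)" "u \<in> I" "v \<in> J" by blast
    show "lorentz (N p) (frechet_derivative Y (at p) w) = 0"
      using XN.normal[OF uv(2,3)]
      unfolding derivative_by_partials[OF has_derivative_linear[OF smooth_on_has_derivative[OF smooth_Y p]], of w] Yu[OF p] Yv[OF p]
      by (simp add: lorentz_simps uv(1))
    show "lorentz (N p) (N p) = - causal_sign Y p"
      using XN.normal(3)[OF uv(2,3)] Y.causal_sign_eq[OF uv(2,3)] uv(1) by simp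
  qed (rule XN.smooth_N)

  interpret Y: curvature_line_surface I J Y \<delta> \<epsilon> \<rho> N \<kappa>\<^sub>1
    using N_Y Nu Nv Yu Yv by unfold_locales auto

  have "associate_surface (I \<times> J) Y X"
  proof (cases "\<tau> = 1")
    case True
    have "conjugate_map (I \<times> J) Y W"
      using Wu Wv True by (intro conjugate_mapI X.open_domain smooth_Y smooth_W) auto
    moreover have "X p = cos (- (2 * c)) *\<^sub>R Y p + sin (- (2 * c)) *\<^sub>R W p" for p
      using X_eq[of p] True by (simp add: C_def S_def)
    moreover have "spacelike_surface (I \<times> J) Y" using Y.spacelike_surface_iff True by (simp add: \<tau>_def)
    moreover have "simply_connected (I \<times> J)" by (rule convex_imp_simply_connected[OF X.convex_domain])
    moreover have "\<forall>p\<in>I \<times> J. fundform1 Y p (1, 0) (1, 0) = fundform1 Y p (0, 1) (0, 1) \<and> fundform1 Y p (1, 0) (0, 1) = 0"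
      using Y.metric True \<tau>(3) by (auto simp: fundform1_def)
    ultimately show ?thesis unfolding associate_surface_def using Y.zero_mean_curvature by blast
  next
    case False
    then have \<tau>1: "\<tau> = - 1" using \<tau> by simp
    have dW: "frechet_derivative (\<lambda>p. - W p) (at p) w = - frechet_derivative W (at p) w" 
        "(\<lambda>p. - W p) differentiable (at p)" if "p \<in> I \<times> J" for p w
    proof -
      have D: "((\<lambda>p. - W p) has_derivative (\<lambda>w. - frechet_derivative W (at p) w)) (at p)"
        by (intro derivative_intros smooth_on_has_derivative[OF smooth_W that])
      show "frechet_derivative (\<lambda>p. - W p) (at p) w = - frechet_derivative W (at p) w"
        using fun_cong[OF frechet_derivative_at[OF D], of w] by simp
      show "(\<lambda>p. - W p) differentiable (at p)"
        using D by (rule differentiableI)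
    qed
    have "paraconjugate_map (I \<times> J) Y (\<lambda>p. - W p)"
      unfolding paraconjugate_map_def using Wu Wv dW \<tau>1 by auto
    moreover have "X p = cosh (2 * c) *\<^sub>R Y p + sinh (2 * c) *\<^sub>R (- W p)" for p
      using X_eq[of p] \<tau>1 by (simp add: C_def S_def)
    moreover have "timelike_surface (I \<times> J) Y" using Y.timelike_surface_iff \<tau>1 by (simp add: \<tau>_def)
    moreover have "\<forall>p\<in>I \<times> J. fundform1 Y p (1, 0) (1, 0) = - fundform1 Y p (0, 1) (0, 1) \<and> fundform1 Y p (1, 0) (0, 1) = 0"
      using Y.metric \<tau>1 \<tau>(3) by (auto simp: fundform1_def)
    ultimately show ?thesis unfolding associate_surface_def using Y.zero_mean_curvature by blast
  qed
  then show ?thesis using Y.surface_of_revolution Y.zero_mean_curvature by blast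
qed

end
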